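(* Let $\mathscr C$ be a class of graphs and let $a,b>0$ be reals such that $\mathrm{Exp}_{\mathscr C}(r)\le a\,(r+\tfrac12)^b$ for every half-integer $r\ge0$. For an integer $p\ge2$ such that $\frac{\ln 2}{(24\sqrt2\,a)^{1/b}\,b\,p}\le \frac1e$, define \[ g_p=\max\left(7,\;2\left\lfloor-\frac{2b}{\ln 2}\,W_{-1}\!\left(-\frac{\ln 2}{(24\sqrt{2}\,a)^{1/b}\,b\,p}\right)\right\rfloor+4\right)(p-1). \] Then every graph $G\in\mathscr C$ with $\mathrm{girth}(G)>g_p$ is $p$-path degenerate. Moreover $g_p\sim 4bp\log_2 p$ as $p\to\infty$.
   Context: $W_{-1}$ denotes the branch with index $-1$ of the Lambert $W$ function, i.e. for $t\in[-1/e,0)$, $W_{-1}(t)$ is the unique solution $z\le -1$ of $ze^z=t$. Graphs are finite and simple; the girth of a graph is the length of a shortest cycle ($+\infty$ for a forest). A strict ear of a graph $G$ is a path of $G$ whose internal vertices all have degree $2$ in $G$ and whose two endpoints are distinct. For an integer $p\ge1$, a $p$-reduction of $G$ is the deletion of either an isolated vertex, or a vertex of degree $1$, or the internal vertices of a strict ear of $G$ of length at least $p$. A graph is $p$-path degenerate if it can be reduced to the empty graph by a sequence of $p$-reductions. For a half-integer $r\ge0$, a graph $H$ is a shallow minor of $G$ at depth $r$ if to every $v\in V(H)$ one can associate a rooted tree $(T_v,r_v)$ such that the $T_v$ are vertex-disjoint subgraphs of $G$, each $T_v$ has radius at most $\lceil r\rceil$ from its root, and for every edge $uv\in E(H)$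 there is an edge $e$ of $G$ between $T_u$ and $T_v$ such that the path between $r_u$ and $r_v$ in $T_u\cup T_v\cup\{e\}$ has length at most $2r+1$. $\nabla_r(G)$ is the maximum of $|E(H)|/|V(H)|$ over nonempty shallow minors $H$ of $G$ at depth $r$, and $\mathrm{Exp}_{\mathscr C}(r)=\sup\{\nabla_r(G):G\in\mathscr C\}$. *)

theory Defs
  imports Complex_Main "HOL-Library.Landau_Symbols" "HOL-Library.Extended_Nat" "HOL-Library.Extended_Real"
begin

type_synonym 'a graph = "'a set \<times> 'a set set"

definition verts :: "'a graph \<Rightarrow> 'a set" where "verts G = fst G"
definition edges :: "'a graph \<Rightarrow> 'a set set" where "edges G = snd G"

definition fin_simple_graph :: "'a graph \<Rightarrow> bool" where
  "fin_simple_graph G \<longleftrightarrow> finite (verts G) \<and>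
     (\<forall>e\<in>edges G. \<exists>u v. e = {u, v} \<and> u \<noteq> v \<and> u \<in> verts G \<and> v \<in> verts G)"

definition adj :: "'a graph \<Rightarrow> 'a \<Rightarrow> 'a \<Rightarrow> bool" where
  "adj G u v \<longleftrightarrow> {u, v} \<in> edges G"

definition degree :: "'a graph \<Rightarrow> 'a \<Rightarrow> nat" where
  "degree G v = card {u. {u, v} \<in> edges G}"

definition walk :: "'a graph \<Rightarrow> 'a list \<Rightarrow> bool" where
  "walk G xs \<longleftrightarrow> xs \<noteq> [] \<and> set xs \<subseteq> verts G \<and>
     (\<forall>i. Suc i < length xs \<longrightarrow> adj G (xs ! i) (xs ! Suc i))"

definition gpath :: "'a graph \<Rightarrow> 'a list \<Rightarrow> bool" where
  "gpath G xs \<longleftrightarrow> walk G xs \<and> distinct xs"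

definition is_cycle :: "'a graph \<Rightarrow> 'a list \<Rightarrow> bool" where
  "is_cycle G xs \<longleftrightarrow> gpath G xs \<and> length xs \<ge> 3 \<and> adj G (last xs) (hd xs)"

definition girth :: "'a graph \<Rightarrow> enat" where
  "girth G = (INF xs\<in>{xs. is_cycle G xs}. enat (length xs))"

definition gconnected :: "'a graph \<Rightarrow> bool" where
  "gconnected G \<longleftrightarrow> (\<forall>u\<in>verts G. \<forall>v\<in>verts G. \<exists>xs. walk G xs \<and> hd xs = u \<and> last xs = v)"

definition is_tree :: "'a graph \<Rightarrow> bool" where
  "is_tree G \<longleftrightarrow> fin_simple_graph G \<and> verts G \<noteq> {} \<and> gconnected G \<and> (\<nexists>xs. is_cycle G xs)"

definition gdist :: "'a graph \<Rightarrow> 'a \<Rightarrow> 'a \<Rightarrow> nat" where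
  "gdist G u v = (LEAST n. \<exists>xs. walk G xs \<and> hd xs = u \<and> last xs = v \<and> length xs = Suc n)"

definition subgraph :: "'a graph \<Rightarrow> 'a graph \<Rightarrow> bool" where
  "subgraph T G \<longleftrightarrow> fin_simple_graph T \<and> verts T \<subseteq> verts G \<and> edges T \<subseteq> edges G"

text \<open>H is a shallow minor of G at depth r (r a half-integer): rooted trees (T v, rt v),
  vertex-disjoint subgraphs of G of radius at most ceiling r from the root, and for every edge uv of H
  an edge xy of G with x in T u, y in T v such that the (unique) root-to-root path
  in T u + T v + xy, of length dist(rt u, x) + 1 + dist(y, rt v), has length at most 2r+1.\<close>
definition shallow_minor :: "real \<Rightarrow> 'b graph \<Rightarrow> 'a graph \<Rightarrow> bool" where
  "shallow_minor r H G \<longleftrightarrow> fin_simple_graph H \<and>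
    (\<exists>(T :: 'b \<Rightarrow> 'a graph) (rt :: 'b \<Rightarrow> 'a).
       (\<forall>v\<in>verts H. subgraph (T v) G \<and> is_tree (T v) \<and> rt v \<in> verts (T v) \<and>
           (\<forall>w\<in>verts (T v). real (gdist (T v) (rt v) w) \<le> of_int \<lceil>r\<rceil>)) \<and>
       (\<forall>u\<in>verts H. \<forall>v\<in>verts H. u \<noteq> v \<longrightarrow> verts (T u) \<inter> verts (T v) = {}) \<and>
       (\<forall>u v. {u, v} \<in> edges H \<longrightarrow>
          (\<exists>x\<in>verts (T u). \<exists>y\<in>verts (T v). {x, y} \<in> edges G \<and>
              real (gdist (T u) (rt u) x + 1 + gdist (T v) y (rt v)) \<le> 2 * r + 1)))"

text \<open>nabla_r(G): maximum edge density over nonempty shallow minors at depth r (0 for the empty graph).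
  Shallow minors are taken with vertices in the same type: any shallow minor can be relabelled by its roots.\<close>
definition nabla :: "real \<Rightarrow> 'a graph \<Rightarrow> real" where
  "nabla r G = Sup (insert 0 {real (card (edges H)) / real (card (verts H)) | H :: 'a graph.
                     shallow_minor r H G \<and> verts H \<noteq> {}})"

definition Exp :: "'a graph set \<Rightarrow> real \<Rightarrow> ereal" where
  "Exp C r = (SUP G\<in>C. ereal (nabla r G))"

definition delete_verts :: "'a graph \<Rightarrow> 'a set \<Rightarrow> 'a graph" where
  "delete_verts G S = (verts G - S, {e\<in>edges G. e \<inter> S = {}})"

definition strict_ear :: "'a graph \<Rightarrow> 'a list \<Rightarrow> bool" where
  "strict_ear G xs \<longleftrightarrow> gpath G xs \<and> hd xs \<noteq> last xs \<and>
     (\<forall>i. 0 < i \<and> i < length xs - 1 \<longrightarrow> degree G (xs ! i) = 2)"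

definition p_reduction :: "nat \<Rightarrow> 'a graph \<Rightarrow> 'a graph \<Rightarrow> bool" where
  "p_reduction p G G' \<longleftrightarrow>
     (\<exists>v\<in>verts G. degree G v = 0 \<and> G' = delete_verts G {v}) \<or>
     (\<exists>v\<in>verts G. degree G v = 1 \<and> G' = delete_verts G {v}) \<or>
     (\<exists>xs. strict_ear G xs \<and> length xs - 1 \<ge> p \<and>
            G' = delete_verts G (set (butlast (tl xs))))"

definition p_path_degenerate :: "nat \<Rightarrow> 'a graph \<Rightarrow> bool" where
  "p_path_degenerate p G \<longleftrightarrow> (p_reduction p)\<^sup>*\<^sup>* G ({}, {})"

definition lambert_Wm1 :: "real \<Rightarrow> real" where
  "lambert_Wm1 t = (THE z. z \<le> -1 \<and> z * exp z = t)"

definition gp :: "real \<Rightarrow> real \<Rightarrow> nat \<Rightarrow> int" where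
  "gp a b p = max 7 (2 * \<lfloor>- (2 * b / ln 2) *
        lambert_Wm1 (- (ln 2 / ((24 * sqrt 2 * a) powr (1 / b) * b * real p)))\<rfloor> + 4) * (int p - 1)"

end

(* After all p-reductions a nonempty graph has minimum degree at least 2 and no ear of length p, so
   branch vertices occur every p steps. Give v the weight deg v - 2. By the girth, non-backtracking
   walks from v of length at most j (p - 1) end in distinct vertices, and their number doubles every
   p - 1 steps; hence the ball of radius j (p - 1) around a branch vertex has weight at least
   M = 3 * 2^j - 2. A greedy choice of O(W / M) balls of this radius covers 7/8 of the total weight
   W = 2 (|E| - |V|), and after deleting the uncovered branch vertices and peeling, everything left
   lies within j (p - 1) + (p - 1) div 2 of the chosen centres X. Contracting the Voronoi cells of X,
   which are trees joined pairwise by at most one edge, keeps at least W / 4 + |X| edges, so this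
   shallow minor has density of order 2^j. For j = floor(s) div 2, where s = -(2b / ln 2) W_{-1}(...)
   solves 2^(s/2) = 24 sqrt 2 a (p s / 2)^b, this exceeds the assumed expansion. *)

theory Submission
  imports Defs "HOL-Real_Asymp.Real_Asymp"
begin

text \<open>Depth is the scarce resource: density of order 2^j is wanted at depth about j (p - 1). A
  maximal packing of disjoint balls would cover only at twice their radius and lose half of the
  exponent, so overlapping balls are taken as long as each adds enough new weight, and the branch
  vertices left over are discarded. The quantity carried along is |E| - |V|. Vertices of degree 2
  add no weight to it, peeling does not decrease it, and neither does contracting disjoint trees.
  Discarding branch vertices of total weight w costs at most 2 w, since each weighs at least 1; with
  w at most W / 8, half of the initial value W / 2 survives. Short cycles are excluded at three
  scales: p for ears, 2 j (p - 1) for endpoints of walks, and 4 r + 2 for cells of radius r = j (p -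
  1) + (p - 1) div 2. The last is the largest and is at most (4 j + 4) (p - 1).\<close>

section \<open>Finite simple graphs and girth\<close>

lemma edge_in_verts:
  assumes "fin_simple_graph G" "{u, v} \<in> edges G"
  shows "u \<in> verts G" "v \<in> verts G" "u \<noteq> v"
proof -
  obtain x y where "{u, v} = {x, y}" "x \<noteq> y" "x \<in> verts G" "y \<in> verts G"
    using assms unfolding fin_simple_graph_def by blast
  then show "u \<in> verts G" "v \<in> verts G" "u \<noteq> v"
    by (auto simp: doubleton_eq_iff)
qed

lemma edgeE:
  assumes "fin_simple_graph G" "e \<in> edges G"
  obtains u v where "e = {u, v}" "u \<noteq> v" "u \<in> verts G" "v \<in> verts G"
  using assms unfolding fin_simple_graph_def by metis

lemma adj_commute: "adj G u v = adj G v u"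
  by (simp add: adj_def insert_commute)

lemma finite_edges:
  assumes "fin_simple_graph G"
  shows "finite (edges G)"
proof (rule finite_subset)
  show "edges G \<subseteq> Pow (verts G)"
    using assms unfolding fin_simple_graph_def by fastforce
  show "finite (Pow (verts G))"
    using assms unfolding fin_simple_graph_def by simp
qed

lemma finite_nbrs:
  assumes "fin_simple_graph G"
  shows "finite {u. {u, v} \<in> edges G}"
proof (rule finite_subset)
  show "{u. {u, v} \<in> edges G} \<subseteq> verts G"
    using edge_in_verts[OF assms] by blast
  show "finite (verts G)"
    using assms unfolding fin_simple_graph_def by simp
qed

lemma girth_less_cycle:
  assumes "enat n < girth G" "is_cycle G xs"
  shows "n < length xs"
proof -
  have "girth G \<le> enat (length xs)"
    unfolding girth_def using assms(2) by (intro INF_lower) simp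
  with assms(1) have "enat n < enat (length xs)"
    by (rule less_le_trans)
  then show ?thesis by simp
qed

section \<open>Non-backtracking walks\<close>

text \<open>Only the immediate return is forbidden. This local condition lets walks be extended one
  vertex at a time; that vertices do not repeat is supplied by the girth afterwards.\<close>

fun nbwalk :: "'a graph \<Rightarrow> 'a list \<Rightarrow> bool" where
  "nbwalk G [] \<longleftrightarrow> False"
| "nbwalk G [x] \<longleftrightarrow> x \<in> verts G"
| "nbwalk G (x # y # ys) \<longleftrightarrow> adj G x y \<and> (ys \<noteq> [] \<longrightarrow> x \<noteq> hd ys) \<and> nbwalk G (y # ys)"

lemma nbwalk_tl: "nbwalk G (x # xs) \<Longrightarrow> xs \<noteq> [] \<Longrightarrow> nbwalk G xs"
  by (cases xs) auto

lemma nbwalk_suffix: "nbwalk G (xs @ ys) \<Longrightarrow> ys \<noteq> [] \<Longrightarrow> nbwalk G ys"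
proof (induction xs)
  case (Cons a xs)
  then show ?case using nbwalk_tl[of G a "xs @ ys"] by simp
qed simp

lemma nbwalk_prefix: "nbwalk G (xs @ ys) \<Longrightarrow> fin_simple_graph G \<Longrightarrow> xs \<noteq> [] \<Longrightarrow> nbwalk G xs"
proof (induction xs rule: induct_list012)
  case (2 x)
  then show ?case by (cases ys) (auto simp: adj_def dest: edge_in_verts)
next
  case (3 x y zs)
  then show ?case by (cases zs) auto
qed simp

lemma nbwalk_join:
  assumes "nbwalk G (xs @ [x])" "nbwalk G (x # ys)"
    and "xs \<noteq> [] \<Longrightarrow> ys \<noteq> [] \<Longrightarrow> last xs \<noteq> hd ys"
  shows "nbwalk G (xs @ x # ys)"
  using assms
proof (induction xs rule: induct_list012)
  case (3 a b zs)
  then show ?case by (cases zs) auto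
qed auto

lemma nbwalk_rev:
  assumes "fin_simple_graph G" "nbwalk G xs"
  shows "nbwalk G (rev xs)"
  using assms(2)
proof (induction xs rule: induct_list012)
  case (3 x y zs)
  have "nbwalk G (rev zs @ [y])" using 3 by simp
  moreover have "nbwalk G (y # [x])"
    using 3 edge_in_verts[OF assms(1)] by (auto simp: adj_def insert_commute)
  ultimately have "nbwalk G (rev zs @ y # [x])"
    by (rule nbwalk_join) (use 3 in \<open>auto simp: last_rev\<close>)
  then show ?case by simp
qed auto

lemma nbwalk_walk:
  assumes "fin_simple_graph G" "nbwalk G xs"
  shows "walk G xs"
  using assms(2)
proof (induction xs rule: induct_list012)
  case (3 x y zs)
  then have "walk G (y # zs)" "adj G x y" by auto
  moreover have "x \<in> verts G"
    using \<open>adj G x y\<close> edge_in_verts[OF assms(1)] by (auto simp: adj_def)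
  ultimately show ?case
    by (auto simp: walk_def nth_Cons split: nat.splits)
qed (auto simp: walk_def)

lemma nbwalk_verts: "fin_simple_graph G \<Longrightarrow> nbwalk G xs \<Longrightarrow> set xs \<subseteq> verts G"
  using nbwalk_walk[of G xs] by (simp add: walk_def)

lemma walk_prefix:
  assumes "walk G (xs @ ys)" "xs \<noteq> []"
  shows "walk G xs"
  unfolding walk_def
proof (intro conjI allI impI)
  fix i assume "Suc i < length xs"
  then show "adj G (xs ! i) (xs ! Suc i)"
    using assms(1) unfolding walk_def by (metis Suc_lessD append_eq_conv_conj length_append nth_take trans_less_add1)
qed (use assms in \<open>auto simp: walk_def\<close>)

text \<open>The tail is distinct by induction, so a repeated head closes up a list without
  repetitions. It has at least three vertices because loops and immediate returns are impossible,
  hence it is a cycle of length at most n.\<close>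

lemma nbwalk_distinct:
  assumes "fin_simple_graph G" "enat n < girth G" "nbwalk G xs" "length xs \<le> Suc n"
  shows "distinct xs"
  using assms(3,4)
proof (induction xs)
  case (Cons x xs)
  show ?case
  proof (cases "xs = []")
    case False
    have dxs: "distinct xs"
      using Cons False nbwalk_tl by fastforce
    have "x \<notin> set xs"
    proof
      assume "x \<in> set xs"
      then obtain ys zs where xs: "xs = ys @ x # zs"
        by (meson split_list)
      have "ys \<noteq> []"
        using Cons.prems(1) xs edge_in_verts(3)[OF assms(1), of x x] by (auto simp: adj_def)
      have "length ys \<noteq> 1"
      proof
        assume "length ys = 1"
        then obtain y where "ys = [y]" by (auto simp: length_Suc_conv)
        then show False using Cons.prems(1) xs by auto
      qed
      then have len: "length (x # ys) \<ge> 3"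
        using \<open>ys \<noteq> []\<close> by (cases ys rule: remdups_adj.cases) auto
      have w: "walk G (x # ys @ [x] @ zs)"
        using nbwalk_walk[OF assms(1) Cons.prems(1)] xs by simp
      have "is_cycle G (x # ys)"
        unfolding is_cycle_def gpath_def
      proof (intro conjI)
        show "walk G (x # ys)"
          using walk_prefix[of G "x # ys" "[x] @ zs"] w by simp
        show "distinct (x # ys)" using dxs xs by auto
        have "adj G ((x # ys @ [x] @ zs) ! length ys) ((x # ys @ [x] @ zs) ! Suc (length ys))"
          using w unfolding walk_def by (auto simp del: append_Cons)
        moreover have "(x # ys @ [x] @ zs) ! length ys = last (x # ys)"
          using \<open>ys \<noteq> []\<close> by (auto simp: nth_Cons' nth_append last_conv_nth)
        ultimately show "adj G (last (x # ys)) (hd (x # ys))"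
          by (simp del: nth_Cons_Suc add: nth_Cons)
      qed (use len in auto)
      then have "n < length (x # ys)" by (rule girth_less_cycle[OF assms(2)])
      with Cons.prems(2) xs show False by simp
    qed
    with dxs show ?thesis by simp
  qed simp
qed simp

text \<open>Once the common initial part is stripped, the reverse of one walk followed by the other
  is again non-backtracking with at most 2n edges, so it repeats no vertex; yet both walks have the
  same last vertex.\<close>

lemma nbwalk_unique:
  assumes G: "fin_simple_graph G" and g: "enat (2 * n) < girth G"
    and "nbwalk G xs" "nbwalk G ys" "hd xs = hd ys" "last xs = last ys"
    and "length xs \<le> Suc n" "length ys \<le> Suc n"
  shows "xs = ys"
  using assms(3-)
proof (induction xs arbitrary: ys)
  case (Cons x xs)
  obtain ys' where ys: "ys = x # ys'"
    using Cons.prems by (cases ys) auto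
  have d: "distinct (x # xs)" "distinct (x # ys')"
    using nbwalk_distinct[OF G g Cons.prems(1)] nbwalk_distinct[OF G g Cons.prems(2)]
      Cons.prems ys by auto
  consider "xs = []" | "ys' = []" | "xs \<noteq> []" "ys' \<noteq> []" by blast
  then show ?case
  proof cases
    case 1
    then show ?thesis using Cons.prems ys d by (auto split: if_splits)
  next
    case 2
    then show ?thesis using Cons.prems ys d by (auto split: if_splits)
  next
    case 3
    show ?thesis
    proof (cases "hd xs = hd ys'")
      case True
      have "xs = ys'"
        by (rule Cons.IH) (use Cons.prems ys 3 True nbwalk_tl[of G] in auto)
      then show ?thesis using ys by simp
    next
      case False
      have "nbwalk G (rev xs @ [x])"
        using nbwalk_rev[OF G Cons.prems(1)] by simp
      moreover have "nbwalk G (x # ys')" using Cons.prems ys by simp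
      ultimately have "nbwalk G (rev xs @ x # ys')"
        by (rule nbwalk_join) (use False 3 in \<open>auto simp: last_rev\<close>)
      then have "distinct (rev xs @ x # ys')"
        by (rule nbwalk_distinct[OF G g]) (use Cons.prems ys in auto)
      moreover have "last xs \<in> set xs" "last xs \<in> set ys'"
        using 3 Cons.prems ys last_in_set[of xs] last_in_set[of ys'] by auto
      ultimately show ?thesis by auto
    qed
  qed
qed simp

section \<open>Neighbourhoods\<close>

text \<open>Balls by iteration instead of distances: unreachable vertices need no value, and
  \<open>nbhd_add\<close> together with \<open>nbhd_sym\<close> stands for the triangle
  inequality.\<close>

fun nbhd :: "'a graph \<Rightarrow> 'a set \<Rightarrow> nat \<Rightarrow> 'a set" where
  "nbhd G S 0 = S"
| "nbhd G S (Suc n) = nbhd G S n \<union> {v. \<exists>u\<in>nbhd G S n. adj G v u}"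

lemma nbhd_mono: "m \<le> n \<Longrightarrow> nbhd G S m \<subseteq> nbhd G S n"
  by (induction rule: dec_induct) auto

lemma nbhd_Un: "nbhd G (S \<union> T) n = nbhd G S n \<union> nbhd G T n"
  by (induction n) auto

lemma nbhd_subset_verts:
  assumes "fin_simple_graph G" "S \<subseteq> verts G"
  shows "nbhd G S n \<subseteq> verts G"
  using assms(2) by (induction n) (auto simp: adj_def dest: edge_in_verts[OF assms(1)])

lemma nbhd_eq_UN: "nbhd G S n = (\<Union>x\<in>S. nbhd G {x} n)"
  by (induction n) auto

lemma nbhd_adj_shift:
  "u \<in> nbhd G {v} n \<Longrightarrow> adj G v v' \<Longrightarrow> u \<in> nbhd G {v'} (Suc n)"
  by (induction n arbitrary: u) auto

lemma nbhd_sym_imp: "u \<in> nbhd G {v} n \<Longrightarrow> v \<in> nbhd G {u} n"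
proof (induction n arbitrary: u)
  case (Suc n)
  then consider "u \<in> nbhd G {v} n" | u' where "u' \<in> nbhd G {v} n" "adj G u u'" by auto
  then show ?case
  proof cases
    case 1
    then show ?thesis using Suc.IH by auto
  next
    case 2
    then show ?thesis using Suc.IH nbhd_adj_shift[of v G u' n u] by (simp add: adj_commute)
  qed
qed simp

lemma nbhd_sym: "u \<in> nbhd G {v} n \<longleftrightarrow> v \<in> nbhd G {u} n"
  using nbhd_sym_imp by fast

lemma nbhd_add: "nbhd G (nbhd G S m) n = nbhd G S (m + n)"
  by (induction n) auto

lemma nbwalk_in_nbhd: "nbwalk G xs \<Longrightarrow> hd xs \<in> nbhd G {last xs} (length xs - 1)"
proof (induction xs rule: induct_list012)
  case (3 x y zs)
  then have "y \<in> nbhd G {last (y # zs)} (length zs)" "adj G x y" by auto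
  then show ?case by auto
qed auto

section \<open>Counting non-backtracking walks\<close>

text \<open>Truncated subtraction; \<open>degree_eq\<close> shows it to be exact when all degrees
  are at least 2.\<close>

definition excess :: "'a graph \<Rightarrow> 'a \<Rightarrow> nat" where
  "excess G v = degree G v - 2"

text \<open>Walks grow at the head of the list: they start at \<open>last xs\<close> and end at \<open>hd xs\<close>.\<close>

definition nbwalks :: "'a graph \<Rightarrow> 'a \<Rightarrow> nat \<Rightarrow> 'a list set" where
  "nbwalks G v n = {xs. nbwalk G xs \<and> last xs = v \<and> length xs = Suc n}"

lemma finite_nbwalks:
  assumes "fin_simple_graph G"
  shows "finite (nbwalks G v n)"
proof (rule finite_subset)
  show "nbwalks G v n \<subseteq> {xs. set xs \<subseteq> verts G \<and> length xs = Suc n}"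
    using nbwalk_verts[OF assms] by (auto simp: nbwalks_def)
  show "finite {xs. set xs \<subseteq> verts G \<and> length xs = Suc n}"
    using assms by (intro finite_lists_length_eq) (simp add: fin_simple_graph_def)
qed

lemma card_extensions:
  assumes G: "fin_simple_graph G" and xs: "nbwalk G (x # y # ys)"
  shows "card {z. nbwalk G (z # x # y # ys)} = degree G x - 1"
proof -
  have "{z. nbwalk G (z # x # y # ys)} = {u. {u, x} \<in> edges G} - {y}"
    using xs by (auto simp: adj_def)
  moreover have "y \<in> {u. {u, x} \<in> edges G}"
    using xs by (auto simp: adj_def insert_commute)
  ultimately show ?thesis
    using finite_nbrs[OF G, of x] by (simp add: degree_def)
qed

lemma finite_extensions:
  assumes G: "fin_simple_graph G"
  shows "finite {z. nbwalk G (z # xs)}"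
proof (rule finite_subset)
  show "{z. nbwalk G (z # xs)} \<subseteq> verts G"
    using nbwalk_verts[OF G, of "_ # xs"] by auto
  show "finite (verts G)" using G by (simp add: fin_simple_graph_def)
qed

lemma card_nbwalks_Suc:
  assumes G: "fin_simple_graph G"
  shows "card (nbwalks G v (Suc n)) = (\<Sum>xs\<in>nbwalks G v n. card {z. nbwalk G (z # xs)})"
proof -
  have "nbwalks G v (Suc n) = (\<lambda>(xs, z). z # xs) ` (SIGMA xs:nbwalks G v n. {z. nbwalk G (z # xs)})"
  proof (intro equalityI subsetI)
    fix ys assume ys: "ys \<in> nbwalks G v (Suc n)"
    then obtain z xs where zx: "ys = z # xs" "xs \<noteq> []"
      by (auto simp: nbwalks_def length_Suc_conv)
    then have "xs \<in> nbwalks G v n" "nbwalk G (z # xs)"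
      using ys nbwalk_tl[of G z xs] by (auto simp: nbwalks_def)
    then show "ys \<in> (\<lambda>(xs, z). z # xs) ` (SIGMA xs:nbwalks G v n. {z. nbwalk G (z # xs)})"
      using zx by force
  qed (auto simp: nbwalks_def)
  moreover have "inj_on (\<lambda>(xs, z). z # xs) (SIGMA xs:nbwalks G v n. {z. nbwalk G (z # xs)})"
    by (auto simp: inj_on_def)
  ultimately have "card (nbwalks G v (Suc n)) = card (SIGMA xs:nbwalks G v n. {z. nbwalk G (z # xs)})"
    by (simp add: card_image)
  also have "\<dots> = (\<Sum>xs\<in>nbwalks G v n. card {z. nbwalk G (z # xs)})"
    using finite_nbwalks[OF G] finite_extensions[OF G] by (intro card_SigmaI) auto
  finally show ?thesis .
qed

lemma card_nbwalks_1:
  assumes G: "fin_simple_graph G" and v: "v \<in> verts G"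
  shows "card (nbwalks G v 1) = degree G v"
proof -
  have "nbwalks G v 0 = {[v]}"
    using v by (auto simp: nbwalks_def length_Suc_conv)
  moreover have "{z. nbwalk G [z, v]} = {u. {u, v} \<in> edges G}"
    using v by (auto simp: adj_def)
  ultimately show ?thesis
    using card_nbwalks_Suc[OF G, of v 0] by (simp add: degree_def)
qed

section \<open>Irreducible graphs: growth of non-backtracking walks\<close>

text \<open>The situation when no p-reduction applies. By \<open>girth_p\<close> every
  non-backtracking walk with p edges is a path with distinct ends, so that \<open>no_ear\<close> can
  be applied to it.\<close>

locale subdivided =
  fixes G :: "'a graph" and p :: nat
  assumes simple: "fin_simple_graph G"
    and p: "p \<ge> 2"
    and degree_ge2: "v \<in> verts G \<Longrightarrow> degree G v \<ge> 2"
    and no_ear: "strict_ear G xs \<Longrightarrow> length xs - 1 < p"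
    and girth_p: "enat p < girth G"
begin

lemma fin_verts [simp]: "finite (verts G)"
  using simple by (simp add: fin_simple_graph_def)

lemma nbwalk_extend:
  assumes "nbwalk G xs"
  obtains zs where "length zs = n" "nbwalk G (zs @ xs)"
proof (induction n arbitrary: thesis)
  case 0
  then show ?case using assms by (metis append_Nil list.size(3))
next
  case (Suc n)
  then obtain zs where zs: "length zs = n" "nbwalk G (zs @ xs)" by auto
  have "\<exists>z. nbwalk G (z # zs @ xs)"
  \<comment> \<open>\<open>remdups_adj.cases\<close> serves only as the case split into no, one, or
    at least two vertices.\<close>
  proof (cases "zs @ xs" rule: remdups_adj.cases)
    case 1
    then show ?thesis using zs by simp
  next
    case (2 x)
    then have "x \<in> verts G" using zs by simp
    have "{u. {u, x} \<in> edges G} \<noteq> {}"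
    proof
      assume "{u. {u, x} \<in> edges G} = {}"
      then show False using degree_ge2[OF \<open>x \<in> verts G\<close>] by (simp add: degree_def)
    qed
    then show ?thesis using 2 \<open>x \<in> verts G\<close> by (auto simp: adj_def)
  next
    case (3 x y ys)
    then have "nbwalk G (x # y # ys)" using zs by simp
    then have "x \<in> verts G" using nbwalk_verts[OF simple] by fastforce
    then have "card {z. nbwalk G (z # x # y # ys)} \<noteq> 0"
      using card_extensions[OF simple \<open>nbwalk G (x # y # ys)\<close>] degree_ge2[of x] by simp
    then have "{z. nbwalk G (z # x # y # ys)} \<noteq> {}" by (metis card.empty)
    then show ?thesis using 3 by auto
  qed
  then obtain z where "nbwalk G ((z # zs) @ xs)" by auto
  then show ?case using Suc.prems zs(1) by (metis length_Cons)
qed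

text \<open>With all internal degrees equal to 2 the walk would be a strict ear with p
  edges.\<close>

lemma nbwalk_branch_vertex:
  assumes xs: "nbwalk G xs" and len: "length xs = Suc p"
  obtains as c bs where "xs = as @ c # bs" "as \<noteq> []" "bs \<noteq> []" "degree G c \<ge> 3"
proof -
  have dist: "distinct xs"
    by (rule nbwalk_distinct[OF simple girth_p xs]) (simp add: len)
  have walk: "walk G xs" by (rule nbwalk_walk[OF simple xs])
  have "hd xs \<noteq> last xs"
    using dist len p by (cases xs) (auto split: if_splits)
  then have "\<not> (\<forall>i. 0 < i \<and> i < length xs - 1 \<longrightarrow> degree G (xs ! i) = 2)"
    using no_ear[of xs] dist walk len by (auto simp: strict_ear_def gpath_def)
  then obtain i where i: "0 < i" "i < length xs - 1" "degree G (xs ! i) \<noteq> 2" by blast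
  have "xs ! i \<in> verts G"
    using walk i by (auto simp: walk_def)
  then have "degree G (xs ! i) \<ge> 3" using degree_ge2[of "xs ! i"] i(3) by simp
  moreover have "xs = take i xs @ xs ! i # drop (Suc i) xs"
    using i by (intro id_take_nth_drop) simp
  moreover have "take i xs \<noteq> []" "drop (Suc i) xs \<noteq> []" using i by auto
  ultimately show thesis using that[of "take i xs" "xs ! i" "drop (Suc i) xs"] by blast
qed

text \<open>The source of the doubling. Together with the edge between \<open>x\<close> and
  \<open>y\<close>, p - 1 further steps make a window of p edges, which has an internal branch
  vertex c. Leaving c by another edge and completing to the same length gives the second
  walk.\<close>

lemma two_extensions:
  assumes xs: "nbwalk G (x # y # ys)"
  shows "\<exists>zs zs'. zs \<noteq> zs' \<and> length zs = p - 1 \<and> length zs' = p - 1 \<and>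
     nbwalk G (zs @ x # y # ys) \<and> nbwalk G (zs' @ x # y # ys)"
proof -
  obtain zs where zs: "length zs = p - 1" "nbwalk G (zs @ x # y # ys)"
    using nbwalk_extend[OF xs] by blast
  have "nbwalk G ((zs @ [x, y]) @ ys)" using zs by simp
  then have "nbwalk G (zs @ [x, y])" by (rule nbwalk_prefix[OF _ simple]) simp
  moreover have "length (zs @ [x, y]) = Suc p" using zs p by simp
  ultimately obtain as c bs where
    abc: "zs @ [x, y] = as @ c # bs" "as \<noteq> []" "bs \<noteq> []" "degree G c \<ge> 3"
    by (rule nbwalk_branch_vertex)
  obtain b bs' where bs: "bs @ ys = b # bs'" using abc(3) by (cases bs) auto
  have "(zs @ [x, y]) @ ys = as @ c # b # bs'"
    unfolding abc(1) using bs by simp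
  then have full: "zs @ x # y # ys = as @ c # b # bs'" by simp
  have c: "nbwalk G (c # b # bs')"
    using nbwalk_suffix[of G as "c # b # bs'"] zs full by simp
  have "card {z. nbwalk G (z # c # b # bs')} \<ge> 2"
    using card_extensions[OF simple c] abc(4) by simp
  then have "\<not> {z. nbwalk G (z # c # b # bs')} \<subseteq> {last as}"
    using card_mono[of "{last as}" "{z. nbwalk G (z # c # b # bs')}"] by auto
  then obtain z where z: "nbwalk G (z # c # b # bs')" "z \<noteq> last as" by auto
  obtain as' where as': "length as' = length as - 1" "nbwalk G (as' @ z # c # b # bs')"
    using nbwalk_extend[OF z(1)] by blast
  \<comment> \<open>As \<open>bs\<close> is nonempty, c is \<open>x\<close> or a vertex added after
    it, so the part \<open>as\<close> that gets replaced lies within \<open>zs\<close>.\<close>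
  have "length as < Suc (length zs)"
  proof -
    have "length (zs @ [x, y]) = length as + Suc (length bs)" using abc(1) by simp
    then show ?thesis using abc(3) by (cases bs) auto
  qed
  then have "length as \<le> length zs" by simp
  then obtain us where us: "zs = as @ us" "us @ x # y # ys = c # b # bs'"
    using full unfolding append_eq_append_conv2 by auto
  define zs' where "zs' = as' @ z # us"
  have "zs' @ x # y # ys = as' @ z # c # b # bs'"
    using us(2) by (simp add: zs'_def)
  moreover have "length zs' = p - 1"
    using as'(1) abc(2) zs(1) us(1) by (cases as) (auto simp: zs'_def)
  moreover have "zs \<noteq> zs'"
  proof
    assume "zs = zs'"
    then have "as @ us = (as' @ [z]) @ us"
      using us(1) by (simp add: zs'_def)
    then have "as = as' @ [z]" by (rule append_same_eq[THEN iffD1])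
    then show False using z(2) by simp
  qed
  ultimately show ?thesis using zs as'(2) by metis
qed

text \<open>The hypothesis on n provides the last edge that \<open>two_extensions\<close> starts
  from; concatenation is injective because all lengths are fixed.\<close>

lemma card_nbwalks_double:
  assumes "n \<ge> 1"
  shows "2 * card (nbwalks G v n) \<le> card (nbwalks G v (n + (p - 1)))"
proof -
  define Z where "Z xs = {zs. length zs = p - 1 \<and> nbwalk G (zs @ xs)}" for xs
  have fin: "finite (Z xs)" for xs
  proof (rule finite_subset)
    show "Z xs \<subseteq> {zs. set zs \<subseteq> verts G \<and> length zs = p - 1}"
      using nbwalk_verts[OF simple, of "_ @ xs"] by (fastforce simp: Z_def)
  qed (intro finite_lists_length_eq, simp)
  have two: "2 \<le> card (Z xs)" if xs: "xs \<in> nbwalks G v n" for xs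
  proof -
    obtain x y ys where "xs = x # y # ys"
      using assms xs by (cases xs rule: remdups_adj.cases) (auto simp: nbwalks_def)
    then obtain zs zs' where "zs \<noteq> zs'" "zs \<in> Z xs" "zs' \<in> Z xs"
      using two_extensions[of x y ys] xs by (fastforce simp: nbwalks_def Z_def)
    then have "card {zs, zs'} \<le> card (Z xs)"
      by (intro card_mono fin) auto
    then show ?thesis using \<open>zs \<noteq> zs'\<close> by simp
  qed
  have "2 * card (nbwalks G v n) = (\<Sum>xs\<in>nbwalks G v n. 2)" by simp
  also have "\<dots> \<le> (\<Sum>xs\<in>nbwalks G v n. card (Z xs))" by (intro sum_mono two)
  also have "\<dots> = card (SIGMA xs:nbwalks G v n. Z xs)"
    using finite_nbwalks[OF simple] fin by (intro card_SigmaI[symmetric]) auto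
  also have "\<dots> = card ((\<lambda>(xs, zs). zs @ xs) ` (SIGMA xs:nbwalks G v n. Z xs))"
    by (intro card_image[symmetric]) (auto simp: inj_on_def nbwalks_def Z_def)
  also have "\<dots> \<le> card (nbwalks G v (n + (p - 1)))"
    by (intro card_mono finite_nbwalks[OF simple]) (auto simp: nbwalks_def Z_def last_append)
  finally show ?thesis .
qed

text \<open>Doubling begins at the walks with one edge, of which there are
  \<open>degree G v\<close>; a branch vertex thus contributes a factor of at least 3.\<close>

lemma card_nbwalks_ge:
  assumes "v \<in> verts G"
  shows "2 ^ j * degree G v \<le> card (nbwalks G v (j * (p - 1) + 1))"
proof (induction j)
  case 0
  then show ?case using card_nbwalks_1[OF simple assms] by simp
next
  case (Suc j)
  have "2 ^ Suc j * degree G v \<le> 2 * card (nbwalks G v (j * (p - 1) + 1))"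
    using Suc by simp
  also have "\<dots> \<le> card (nbwalks G v (j * (p - 1) + 1 + (p - 1)))"
    by (rule card_nbwalks_double) simp
  finally show ?case by (simp add: add.commute add.left_commute)
qed

lemma degree_eq: "v \<in> verts G \<Longrightarrow> degree G v = excess G v + 2"
  using degree_ge2[of v] by (simp add: excess_def)

text \<open>A walk with at least one edge that ends in u has \<open>1 + excess G u\<close>
  extensions, the trivial walk has \<open>2 + excess G v\<close>. The count therefore grows by the
  excess at the endpoints, and telescoping turns numbers of walks into weight.\<close>

lemma card_nbwalks_eq:
  assumes v: "v \<in> verts G"
  shows "card (nbwalks G v (Suc n)) = 2 + (\<Sum>t\<le>n. \<Sum>xs\<in>nbwalks G v t. excess G (hd xs))"
proof (induction n)
  case 0
  have "nbwalks G v 0 = {[v]}"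
    using v by (auto simp: nbwalks_def length_Suc_conv)
  then show ?case using card_nbwalks_1[OF simple v] degree_eq[OF v] by simp
next
  case (Suc n)
  have "card {z. nbwalk G (z # xs)} = 1 + excess G (hd xs)" if xs: "xs \<in> nbwalks G v (Suc n)" for xs
  proof -
    obtain x y ys where xs': "xs = x # y # ys"
      using xs by (cases xs rule: remdups_adj.cases) (auto simp: nbwalks_def)
    then have "nbwalk G (x # y # ys)" using xs by (simp add: nbwalks_def)
    moreover from this have "x \<in> verts G" using nbwalk_verts[OF simple] by fastforce
    ultimately show ?thesis
      using card_extensions[OF simple, of x y ys] degree_eq[of x] xs' by simp
  qed
  then have "card (nbwalks G v (Suc (Suc n))) =
      (\<Sum>xs\<in>nbwalks G v (Suc n). 1 + excess G (hd xs))"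
    unfolding card_nbwalks_Suc[OF simple, of v "Suc n"] by (intro sum.cong) auto
  also have "\<dots> = card (nbwalks G v (Suc n)) + (\<Sum>xs\<in>nbwalks G v (Suc n). excess G (hd xs))"
    unfolding sum.distrib by simp
  finally have "card (nbwalks G v (Suc (Suc n))) =
      card (nbwalks G v (Suc n)) + (\<Sum>xs\<in>nbwalks G v (Suc n). excess G (hd xs))" .
  then show ?case using Suc by simp
qed

text \<open>By the girth, different walks of length at most \<open>n\<close> from \<open>v\<close> have different endpoints.\<close>

lemma card_nbwalks_le:
  assumes v: "v \<in> verts G" and g: "enat (2 * n) < girth G"
  shows "card (nbwalks G v (Suc n)) \<le> 2 + sum (excess G) (nbhd G {v} n)"
proof -
  let ?A = "\<Union>t\<le>n. nbwalks G v t"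
  have "(\<Sum>t\<le>n. \<Sum>xs\<in>nbwalks G v t. excess G (hd xs)) = (\<Sum>xs\<in>?A. excess G (hd xs))"
    using finite_nbwalks[OF simple]
    by (intro sum.UNION_disjoint[symmetric]) (auto simp: nbwalks_def)
  also have "\<dots> = sum (excess G) (hd ` ?A)"
  proof (rule sum.reindex_cong[symmetric])
    show "inj_on hd ?A"
      by (auto simp: inj_on_def nbwalks_def intro!: nbwalk_unique[OF simple g])
  qed auto
  also have "\<dots> \<le> sum (excess G) (nbhd G {v} n)"
  proof (rule sum_mono2)
    show "finite (nbhd G {v} n)"
      using nbhd_subset_verts[OF simple, of "{v}" n] v finite_subset[OF _ fin_verts] by simp
    show "hd ` ?A \<subseteq> nbhd G {v} n"
    proof safe
      fix xs t assume "t \<le> n" "xs \<in> nbwalks G v t"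
      then have "hd xs \<in> nbhd G {v} t"
        using nbwalk_in_nbhd[of G xs] by (simp add: nbwalks_def)
      then show "hd xs \<in> nbhd G {v} n" using nbhd_mono[OF \<open>t \<le> n\<close>, of G "{v}"] by auto
    qed
  qed simp
  finally show ?thesis unfolding card_nbwalks_eq[OF v] by simp
qed

text \<open>Walks one step longer than the radius are counted: there are at least
  \<open>3 * 2 ^ j\<close> of them, and their number exceeds the weight of the ball by at most
  2.\<close>

lemma excess_nbhd_ge:
  assumes v: "v \<in> verts G" and deg: "excess G v > 0" and g: "enat (2 * (j * (p - 1))) < girth G"
  shows "3 * 2 ^ j - 2 \<le> sum (excess G) (nbhd G {v} (j * (p - 1)))"
proof -
  have "2 ^ j * 3 \<le> 2 ^ j * degree G v"
    using degree_eq[OF v] deg by simp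
  also have "\<dots> \<le> card (nbwalks G v (Suc (j * (p - 1))))"
    using card_nbwalks_ge[OF v, of j] by simp
  also have "\<dots> \<le> 2 + sum (excess G) (nbhd G {v} (j * (p - 1)))"
    by (rule card_nbwalks_le[OF v g])
  finally show ?thesis by simp
qed

end

section \<open>The Voronoi forest of a set of roots\<close>

lemma walk_single [simp]: "walk G [x] \<longleftrightarrow> x \<in> verts G"
  by (simp add: walk_def)

lemma walk_Cons_Cons [simp]:
  "walk G (x # y # ys) \<longleftrightarrow> x \<in> verts G \<and> adj G x y \<and> walk G (y # ys)"
proof -
  \<comment> \<open>Splitting off index 0 turns the indexed condition into a recursion along the
    list.\<close>
  have "(\<forall>i. Q i) \<longleftrightarrow> Q 0 \<and> (\<forall>i. Q (Suc i))" for Q :: "nat \<Rightarrow> bool"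
    by (metis nat.exhaust)
  from this[of "\<lambda>i. Suc i < length (x # y # ys) \<longrightarrow> adj G ((x # y # ys) ! i) ((x # y # ys) ! Suc i)"]
  show ?thesis unfolding walk_def by (simp only: nth_Cons_Suc nth_Cons_0 length_Cons Suc_less_eq) auto
qed

lemma walk_join: "walk G (xs @ [x]) \<Longrightarrow> walk G (x # ys) \<Longrightarrow> walk G (xs @ x # ys)"
  by (induction xs rule: induct_list012) auto

lemma walk_rev: "walk G xs \<Longrightarrow> walk G (rev xs)"
proof (induction xs rule: induct_list012)
  case (3 x y zs)
  then have "walk G (rev zs @ [y])" by simp
  moreover have "y \<in> verts G" using 3 by (simp add: walk_def)
  then have "walk G [y, x]" using 3 by (simp add: adj_commute)
  ultimately show ?case using walk_join[of G "rev zs" y "[x]"] by simp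
qed (auto simp: walk_def)

lemma gdist_le_walk: "walk G xs \<Longrightarrow> gdist G (hd xs) (last xs) \<le> length xs - 1"
  unfolding gdist_def by (intro Least_le exI[of _ xs]) (auto simp: walk_def)

text \<open>Serves to exclude cycles from rooted trees: a deepest vertex of a cycle would need two
  different parents.\<close>

lemma is_cycle_neighbours:
  assumes "is_cycle G xs" "i < length xs"
  obtains u w where "u \<in> set xs" "w \<in> set xs" "u \<noteq> w" "adj G (xs ! i) u" "adj G (xs ! i) w"
proof -
  have len: "length xs \<ge> 3" and dist: "distinct xs" and w: "walk G xs" and
    "adj G (last xs) (hd xs)"
    using assms(1) by (auto simp: is_cycle_def gpath_def)
  have "xs \<noteq> []" using len by auto
  with \<open>adj G (last xs) (hd xs)\<close> have closing: "adj G (xs ! (length xs - 1)) (xs ! 0)"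
    by (simp add: last_conv_nth hd_conv_nth)
  have step: "adj G (xs ! k) (xs ! Suc k)" if "Suc k < length xs" for k
    using w that by (simp add: walk_def)
  consider "i = 0" | "i = length xs - 1" | "0 < i" "Suc i < length xs"
    using assms(2) by linarith
  then show thesis
  proof cases
    case 1
    show thesis
      by (rule that[of "xs ! 1" "xs ! (length xs - 1)"])
        (use 1 len dist closing step[of 0] in \<open>auto simp: nth_eq_iff_index_eq adj_commute\<close>)
  next
    case 2
    have "Suc (length xs - 2) = length xs - 1" using len by simp
    then have "adj G (xs ! i) (xs ! (length xs - 2))"
      using step[of "length xs - 2"] len 2 by (simp add: adj_commute)
    moreover have "xs ! 0 \<noteq> xs ! (length xs - 2)"
      using len dist by (subst nth_eq_iff_index_eq) auto
    moreover have "adj G (xs ! i) (xs ! 0)" using closing 2 by simp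
    moreover have "xs ! 0 \<in> set xs" "xs ! (length xs - 2) \<in> set xs" 
      using len \<open>xs \<noteq> []\<close> nth_mem[of "length xs - 2" xs] by simp_all
    ultimately show thesis using that by blast
  next
    case 3
    show thesis
      by (rule that[of "xs ! Suc i" "xs ! (i - 1)"])
        (use 3 dist step[of i] step[of "i - 1"] in \<open>auto simp: nth_eq_iff_index_eq adj_commute\<close>)
  qed
qed

lemma takeWhile_dropWhile_append:
  assumes "\<forall>x\<in>set xs. P x" "ys \<noteq> []" "\<not> P (hd ys)"
  shows "takeWhile P (xs @ ys) = xs \<and> dropWhile P (xs @ ys) = ys"
proof -
  have "takeWhile P ys = []" "dropWhile P ys = ys" using assms(2,3) by (cases ys; simp)+
  then show ?thesis using assms(1) by (simp add: takeWhile_append dropWhile_append)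
qed

text \<open>Two connections of at most \<open>2 * r + 1\<close> edges between the same pair of roots
  would close up within \<open>4 * r + 2\<close> edges, which the girth bound forbids.\<close>

locale voronoi =
  fixes G :: "'a graph" and X :: "'a set" and r :: nat
  assumes simple: "fin_simple_graph G"
    and roots: "X \<subseteq> verts G"
    and girth: "enat (4 * r + 2) < girth G"
begin

abbreviation C where "C \<equiv> nbhd G X r"

definition rank :: "'a \<Rightarrow> nat" where
  "rank v = (LEAST n. v \<in> nbhd G X n)"

text \<open>Ties between equally near roots are settled here once and for all: cells are defined by
  following parents, so each is connected and closed under \<open>par\<close>.\<close>

definition par :: "'a \<Rightarrow> 'a" where
  "par v = (SOME u. u \<in> C \<and> adj G v u \<and> Suc (rank u) = rank v)"

definition root :: "'a \<Rightarrow> 'a" where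
  "root v = (par ^^ rank v) v"

definition upath :: "'a \<Rightarrow> 'a list" where
  "upath v = map (\<lambda>i. (par ^^ i) v) [0..<Suc (rank v)]"

definition tree :: "'a \<Rightarrow> 'a graph" where
  "tree x = ({v \<in> C. root v = x}, {{v, par v} | v. v \<in> C - X \<and> root v = x})"

lemma C_subset: "C \<subseteq> verts G"
  by (rule nbhd_subset_verts[OF simple roots])

lemma roots_in_C: "X \<subseteq> C"
  using nbhd_mono[of 0 r G X] by simp

lemma rank_le: "v \<in> nbhd G X n \<Longrightarrow> rank v \<le> n"
  unfolding rank_def by (rule Least_le)

lemma nbhd_rank: "v \<in> nbhd G X n \<Longrightarrow> v \<in> nbhd G X (rank v)"
  unfolding rank_def by (rule LeastI)

lemma rank_root: "v \<in> X \<Longrightarrow> rank v = 0"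
  using rank_le[of v 0] by simp

lemma par_props:
  assumes "v \<in> C - X"
  shows "adj G v (par v)" "Suc (rank (par v)) = rank v" "par v \<in> C"
proof -
  have v: "v \<in> nbhd G X (rank v)" using nbhd_rank assms by auto
  then have "rank v \<noteq> 0" using assms by (cases "rank v") auto
  then obtain m where m: "rank v = Suc m" by (cases "rank v") auto
  have "v \<notin> nbhd G X m" using rank_le[of v m] m by auto
  then obtain u where u: "u \<in> nbhd G X m" "adj G v u" using v m by auto
  have "rank u = m"
  proof (rule ccontr)
    assume "rank u \<noteq> m"
    then have "Suc (rank u) \<le> m" using rank_le[OF u(1)] by simp
    moreover have "v \<in> nbhd G X (Suc (rank u))" using nbhd_rank[OF u(1)] u(2) by auto
    ultimately show False using \<open>v \<notin> nbhd G X m\<close> nbhd_mono[of "Suc (rank u)" m G X] by auto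
  qed
  moreover have "u \<in> C" using u(1) nbhd_mono[of m r G X] m rank_le[of v r] assms by auto
  ultimately have "\<exists>u. u \<in> C \<and> adj G v u \<and> Suc (rank u) = rank v" using u m by auto
  then have "par v \<in> C \<and> adj G v (par v) \<and> Suc (rank (par v)) = rank v"
    unfolding par_def by (rule someI_ex)
  then show "adj G v (par v)" "Suc (rank (par v)) = rank v" "par v \<in> C" by auto
qed

lemma root_root [simp]: "v \<in> X \<Longrightarrow> root v = v"
  by (simp add: root_def rank_root)

lemma root_par: "v \<in> C - X \<Longrightarrow> root (par v) = root v"
  unfolding root_def using par_props(2)[of v, symmetric] by (simp add: funpow_swap1)

lemma upath_root [simp]: "v \<in> X \<Longrightarrow> upath v = [v]"
  by (simp add: upath_def rank_root)

lemma upath_step: "v \<in> C - X \<Longrightarrow> upath v = v # upath (par v)"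
  unfolding upath_def
  by (simp add: upt_conv_Cons funpow_swap1 comp_def flip: par_props(2) map_Suc_upt del: upt_Suc)

lemma rank_induct [consumes 1, case_names root step]:
  assumes "v \<in> C"
    and "\<And>v. v \<in> X \<Longrightarrow> P v"
    and "\<And>v. v \<in> C - X \<Longrightarrow> par v \<in> C \<Longrightarrow> P (par v) \<Longrightarrow> P v"
  shows "P v"
  using assms(1)
proof (induction "rank v" arbitrary: v rule: less_induct)
  case less
  then show ?case
    using assms(2,3) par_props[of v] by (cases "v \<in> X") force+
qed

lemma root_in: "v \<in> C \<Longrightarrow> root v \<in> X"
  by (induction rule: rank_induct) (auto simp: root_par)

lemma upath_Cons: "v \<in> C \<Longrightarrow> \<exists>us. upath v = v # us \<and> (us \<noteq> [] \<longrightarrow> v \<in> C - X \<and> hd us = par v)"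
proof (cases "v \<in> X")
  case False
  assume "v \<in> C"
  then have v: "v \<in> C - X" using False by simp
  have "hd (upath (par v)) = par v" by (simp add: upath_def upt_conv_Cons del: upt_Suc)
  then show ?thesis using upath_step[OF v] v by auto
qed simp

lemma hd_upath [simp]: "hd (upath v) = v"
  by (simp add: upath_def upt_conv_Cons del: upt_Suc)

lemma last_upath [simp]: "last (upath v) = root v"
  by (simp add: upath_def root_def)

lemma length_upath [simp]: "length (upath v) = Suc (rank v)"
  by (simp add: upath_def)

lemma upath_not_Nil [simp]: "upath v \<noteq> []"
  by (simp add: upath_def)

lemma nbwalk_upath: "v \<in> C \<Longrightarrow> nbwalk G (upath v)"
proof (induction rule: rank_induct)
  case (root v)
  then show ?case using roots by auto
next
  case (step v)
  obtain us where us: "upath (par v) = par v # us" "us \<noteq> [] \<longrightarrow> par v \<in> C - X \<and> hd us = par (par v)"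
    using upath_Cons[OF step(2)] by blast
  \<comment> \<open>The rank drops by one at each step, so the grandparent differs from
    \<open>v\<close>.\<close>
  have "us \<noteq> [] \<longrightarrow> v \<noteq> hd us"
    using us(2) par_props(2)[of v] par_props(2)[of "par v"] step(1) by force
  then show ?case using us step par_props(1)[of v] by (simp add: upath_step)
qed

lemma root_upath: "v \<in> C \<Longrightarrow> u \<in> set (upath v) \<Longrightarrow> root u = root v"
  by (induction arbitrary: u rule: rank_induct) (auto simp: upath_step root_par)

lemma walk_tree_upath: "v \<in> C \<Longrightarrow> walk (tree (root v)) (upath v)"
proof (induction rule: rank_induct)
  case (root v)
  then show ?case using roots_in_C by (auto simp: tree_def verts_def)
next
  case (step v)
  then show ?case
    using upath_Cons[OF step(2)] 
    by (auto simp: upath_step root_par tree_def verts_def edges_def adj_def)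
qed

text \<open>At a vertex of maximal rank on a cycle both neighbours would have to be its
  parent.\<close>

lemma tree_no_cycle: "\<not> is_cycle (tree x) xs"
proof
  assume cyc: "is_cycle (tree x) xs"
  then have "xs \<noteq> []" by (auto simp: is_cycle_def)
  then have "Max (rank ` set xs) \<in> rank ` set xs" by (intro Max_in) auto
  then obtain i where i: "i < length xs" "rank (xs ! i) = Max (rank ` set xs)"
    by (auto simp: in_set_conv_nth)
  then have max: "rank u \<le> rank (xs ! i)" if "u \<in> set xs" for u using that by simp
  have "u = par (xs ! i)" if "u \<in> set xs" "adj (tree x) (xs ! i) u" for u
  proof -
    from that(2) obtain z where "{xs ! i, u} = {z, par z}" "z \<in> C - X"
      by (auto simp: adj_def edges_def tree_def)
    then show ?thesis
      using par_props(2)[of z] max[OF that(1)] by (auto simp: doubleton_eq_iff)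
  qed
  then show False using is_cycle_neighbours[OF cyc i(1)] by metis
qed

lemma tree_is_tree:
  assumes "x \<in> X"
  shows "subgraph (tree x) G" "is_tree (tree x)"
proof -
  have simp_tree: "fin_simple_graph (tree x)"
    unfolding fin_simple_graph_def
  proof (intro conjI ballI)
    have "finite C" using C_subset simple finite_subset by (auto simp: fin_simple_graph_def)
    then show "finite (verts (tree x))" by (simp add: tree_def verts_def)
    fix e assume "e \<in> edges (tree x)"
    then obtain v where v: "e = {v, par v}" "v \<in> C - X" "root v = x"
      by (auto simp: tree_def edges_def)
    have "v \<noteq> par v" using par_props(2)[OF v(2)] by auto
    then show "\<exists>u v. e = {u, v} \<and> u \<noteq> v \<and> u \<in> verts (tree x) \<and> v \<in> verts (tree x)"
      using v par_props(3)[OF v(2)] root_par[OF v(2)]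
      by (intro exI[of _ v] exI[of _ "par v"]) (auto simp: tree_def verts_def)
  qed
  moreover have "verts (tree x) \<subseteq> verts G"
    using C_subset by (auto simp: tree_def verts_def)
  moreover have "edges (tree x) \<subseteq> edges G"
  proof
    fix e assume "e \<in> edges (tree x)"
    then obtain v where "e = {v, par v}" "v \<in> C - X"
      by (auto simp: tree_def edges_def)
    then show "e \<in> edges G" using par_props(1)[of v] by (simp add: adj_def)
  qed
  ultimately show "subgraph (tree x) G" by (simp add: subgraph_def)
  have "gconnected (tree x)"
    unfolding gconnected_def
  proof (intro ballI)
    fix u v assume "u \<in> verts (tree x)" "v \<in> verts (tree x)"
    then have uv: "u \<in> C" "v \<in> C" "root u = x" "root v = x" by (auto simp: tree_def verts_def)
    have "upath u = butlast (upath u) @ [x]"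
      using append_butlast_last_id[of "upath u"] uv by simp
    then have w1: "walk (tree x) (butlast (upath u) @ [x])" using walk_tree_upath[of u] uv by simp
    obtain ys where ys: "rev (upath v) = x # ys"
      using uv hd_rev[of "upath v"] by (cases "rev (upath v)") auto
    then have w2: "walk (tree x) (x # ys)" using walk_rev walk_tree_upath[of v] uv by metis
    have "hd (butlast (upath u) @ x # ys) = u"
      using \<open>upath u = butlast (upath u) @ [x]\<close> hd_upath[of u] by (metis hd_append list.sel(1))
    moreover have "last (butlast (upath u) @ x # ys) = v"
      using last_rev[of "upath v"] unfolding ys by simp
    ultimately show "\<exists>xs. walk (tree x) xs \<and> hd xs = u \<and> last xs = v"
      using walk_join[OF w1 w2] by blast
  qed
  moreover have "x \<in> verts (tree x)"
    using assms roots_in_C by (auto simp: tree_def verts_def)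
  ultimately show "is_tree (tree x)"
    using simp_tree tree_no_cycle by (auto simp: is_tree_def)
qed

lemma gdist_tree:
  assumes "v \<in> C"
  shows "gdist (tree (root v)) (root v) v \<le> rank v" "gdist (tree (root v)) v (root v) \<le> rank v"
proof -
  have w: "walk (tree (root v)) (upath v)" by (rule walk_tree_upath[OF assms])
  show "gdist (tree (root v)) v (root v) \<le> rank v"
    using gdist_le_walk[OF w] by simp
  show "gdist (tree (root v)) (root v) v \<le> rank v"
    using gdist_le_walk[OF walk_rev[OF w]] by (simp add: hd_rev last_rev)
qed

definition cross :: "'a set set" where
  "cross = {e \<in> edges G. e \<subseteq> C \<and> (\<forall>v\<in>C - X. e \<noteq> {v, par v})}"

definition link :: "'a \<Rightarrow> 'a \<Rightarrow> 'a list" where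
  "link u v = rev (upath u) @ upath v"

text \<open>The walk does not turn back at its middle edge, because neither end of that edge is the
  parent of the other.\<close>

lemma link:
  assumes "{u, v} \<in> cross"
  shows "nbwalk G (link u v)" "hd (link u v) = root u" "last (link u v) = root v"
    "length (link u v) \<le> Suc (2 * r + 1)"
proof -
  have uv: "u \<in> C" "v \<in> C" "{u, v} \<in> edges G"
    "u \<in> C - X \<Longrightarrow> v \<noteq> par u" "v \<in> C - X \<Longrightarrow> u \<noteq> par v"
    using assms by (auto simp: cross_def)
  obtain us where us: "upath u = u # us" "us \<noteq> [] \<longrightarrow> u \<in> C - X \<and> hd us = par u"
    using upath_Cons[OF uv(1)] by blast
  obtain vs where vs: "upath v = v # vs" "vs \<noteq> [] \<longrightarrow> v \<in> C - X \<and> hd vs = par v"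
    using upath_Cons[OF uv(2)] by blast
  have "nbwalk G (rev us @ [u])"
    using nbwalk_rev[OF simple nbwalk_upath[OF uv(1)]] us by simp
  moreover have "nbwalk G (u # upath v)"
    using nbwalk_upath[OF uv(2)] vs uv by (auto simp: adj_def)
  ultimately have "nbwalk G (rev us @ u # upath v)"
    by (rule nbwalk_join) (use us vs uv in \<open>auto simp: last_rev\<close>)
  then show "nbwalk G (link u v)" using us by (simp add: link_def)
  show "hd (link u v) = root u" "last (link u v) = root v" by (simp_all add: link_def hd_rev)
  show "length (link u v) \<le> Suc (2 * r + 1)"
    using rank_le[OF uv(1)] rank_le[OF uv(2)] by (simp add: link_def)
qed

text \<open>The link has at most \<open>2 * r + 1\<close> edges, so by the girth it repeats no
  vertex; in particular its two ends differ.\<close>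

lemma cross_roots:
  assumes "{u, v} \<in> cross"
  shows "root u \<noteq> root v"
proof -
  have "enat (2 * r + 1) \<le> enat (4 * r + 2)" by simp
  then have "enat (2 * r + 1) < girth G" using girth by (rule le_less_trans)
  then have "distinct (link u v)"
    by (rule nbwalk_distinct[OF simple _ link(1)[OF assms] link(4)[OF assms]])
  moreover have "root u \<in> set (upath u)" "root v \<in> set (upath v)"
    using last_in_set[OF upath_not_Nil] last_upath by metis+
  ultimately show ?thesis by (auto simp: link_def)
qed

text \<open>Links between the same two roots coincide by \<open>nbwalk_unique\<close>, and a link
  determines its middle edge.\<close>

lemma cross_inj_aux:
  assumes "{u, v} \<in> cross" "{u', v'} \<in> cross" "root u = root u'" "root v = root v'"
  shows "{u, v} = {u', v'}"
proof -
  have "enat (2 * (2 * r + 1)) < girth G" using girth by simp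
  then have eq: "link u v = link u' v'"
    by (rule nbwalk_unique[OF simple]) (use link assms in auto)
  \<comment> \<open>\<open>root\<close> is constant on either half of a link and takes different
    values on them, so the place where it changes marks the edge.\<close>
  have split: "takeWhile (\<lambda>z. root z = root u) (link u v) = rev (upath u) \<and>
      dropWhile (\<lambda>z. root z = root u) (link u v) = upath v" if "{u, v} \<in> cross" for u v
  proof -
    have "root v \<noteq> root u" using cross_roots[OF that] by simp
    moreover have "u \<in> C" "v \<in> C" using that by (auto simp: cross_def)
    ultimately have "\<forall>z\<in>set (rev (upath u)). root z = root u" "root (hd (upath v)) \<noteq> root u"
      using root_upath[of u] by auto
    then show ?thesis
      unfolding link_def by (intro takeWhile_dropWhile_append) auto
  qed
  have "rev (upath u) = rev (upath u')" "upath v = upath v'"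
    using split[OF assms(1)] split[OF assms(2)] unfolding eq assms(3) by (metis, metis)
  then have "hd (upath u) = hd (upath u')" "hd (upath v) = hd (upath v')" by simp_all
  then show ?thesis by simp
qed

lemma edge_cases: "e \<in> edges G \<Longrightarrow> \<exists>u v. e = {u, v}"
proof -
  assume "e \<in> edges G"
  with simple obtain u v where "e = {u, v}" unfolding fin_simple_graph_def by metis
  then show ?thesis by (intro exI)
qed

lemma cross_inj: "inj_on ((`) root) cross"
proof (rule inj_onI)
  fix e e' assume e: "e \<in> cross" "e' \<in> cross" "root ` e = root ` e'"
  obtain u v where uv: "e = {u, v}" using e(1) edge_cases[of e] unfolding cross_def by blast
  obtain u' v' where uv': "e' = {u', v'}" using e(2) edge_cases[of e'] unfolding cross_def by blast
  have "{root u, root v} = {root u', root v'}" using e(3) uv uv' by simp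
  then consider "root u = root u'" "root v = root v'" | "root u = root v'" "root v = root u'"
    by (auto simp: doubleton_eq_iff)
  then show "e = e'"
  proof cases
    case 1
    then show ?thesis using cross_inj_aux e uv uv' by simp
  next
    case 2
    then show ?thesis using cross_inj_aux[of u v v' u'] e uv uv' by (simp add: insert_commute)
  qed
qed

text \<open>Cells are named by their roots, which keeps the minor in the vertex type over which
  \<open>nabla\<close> ranges.\<close>

definition minor :: "'a graph" where
  "minor = (X, (`) root ` cross)"

lemma minor_edge:
  assumes "{a, b} \<in> edges minor"
  obtains u v where "{u, v} \<in> cross" "a = root u" "b = root v"
proof -
  obtain e where e: "e \<in> cross" "{a, b} = root ` e"
    using assms by (auto simp: minor_def edges_def)
  obtain u v where uv: "e = {u, v}" using e(1) edge_cases[of e] unfolding cross_def by blast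
  then have "{a, b} = {root u, root v}" using e by simp
  then consider "a = root u" "b = root v" | "a = root v" "b = root u"
    by (auto simp: doubleton_eq_iff)
  then show thesis using that[of u v] that[of v u] e(1) uv by (metis insert_commute)
qed

lemma shallow_minor: "shallow_minor (real r) minor G"
  unfolding shallow_minor_def
proof (intro conjI exI[of _ tree] exI[of _ id] ballI allI impI)
  show "fin_simple_graph minor"
    unfolding fin_simple_graph_def
  proof (intro conjI ballI)
    show "finite (verts minor)"
      using roots simple finite_subset by (auto simp: minor_def verts_def fin_simple_graph_def)
    fix e assume "e \<in> edges minor"
    then obtain f where f: "f \<in> cross" "e = root ` f" by (auto simp: minor_def edges_def)
    obtain u v where uv: "f = {u, v}" using f(1) edge_cases[of f] unfolding cross_def by blast
    then have "u \<in> C" "v \<in> C" using f(1) by (auto simp: cross_def)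
    then show "\<exists>u v. e = {u, v} \<and> u \<noteq> v \<and> u \<in> verts minor \<and> v \<in> verts minor"
      using root_in cross_roots f uv
      by (intro exI[of _ "root u"] exI[of _ "root v"]) (auto simp: minor_def verts_def)
  qed
next
  fix x assume "x \<in> verts minor"
  then have x: "x \<in> X" by (simp add: minor_def verts_def)
  then show "subgraph (tree x) G" "is_tree (tree x)" by (rule tree_is_tree)+
  show "id x \<in> verts (tree x)" using x roots_in_C by (auto simp: tree_def verts_def)
  fix w assume "w \<in> verts (tree x)"
  then have "w \<in> C" "root w = x" by (auto simp: tree_def verts_def)
  then have "gdist (tree x) x w \<le> r" using gdist_tree(1)[of w] rank_le[of w r] by simp
  then show "real (gdist (tree x) (id x) w) \<le> of_int \<lceil>real r\<rceil>" by simp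
next
  fix x y :: 'a assume "x \<noteq> y"
  then show "verts (tree x) \<inter> verts (tree y) = {}" by (auto simp: tree_def verts_def)
next
  fix a b assume "{a, b} \<in> edges minor"
  then obtain u v where uv: "{u, v} \<in> cross" "a = root u" "b = root v" by (rule minor_edge)
  then have C: "u \<in> C" "v \<in> C" "{u, v} \<in> edges G" by (auto simp: cross_def)
  have "gdist (tree a) a u + 1 + gdist (tree b) v b \<le> 2 * r + 1"
    using gdist_tree(1)[OF C(1)] gdist_tree(2)[OF C(2)] rank_le[OF C(1)] rank_le[OF C(2)] uv by simp
  then have "real (gdist (tree a) (id a) u + 1 + gdist (tree b) v (id b)) \<le> 2 * real r + 1"
    unfolding id_def by linarith
  then show "\<exists>x\<in>verts (tree a). \<exists>y\<in>verts (tree b). {x, y} \<in> edges G \<and>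
      real (gdist (tree a) (id a) x + 1 + gdist (tree b) y (id b)) \<le> 2 * real r + 1"
    using C uv by (intro bexI[of _ u] bexI[of _ v]) (auto simp: tree_def verts_def)
qed

text \<open>The cells are built in all of \<open>C\<close>, because shortest paths to
  \<open>X\<close> may leave \<open>S\<close>. An edge inside \<open>S\<close> is a cross edge or
  the parent edge of a vertex of \<open>S - X\<close>, and each such vertex has only one.\<close>

lemma card_edges_minor:
  assumes "S \<subseteq> C" "X \<subseteq> S"
  shows "card {e \<in> edges G. e \<subseteq> S} + card X \<le> card (edges minor) + card S"
proof -
  have fin: "finite S" "finite cross"
    using assms(1) C_subset simple finite_edges[OF simple] finite_subset[of S "verts G"]
    by (auto simp: fin_simple_graph_def cross_def)
  have "{e \<in> edges G. e \<subseteq> S} \<subseteq> cross \<union> (\<lambda>v. {v, par v}) ` (S - X)"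
    using assms(1) by (auto simp: cross_def)
  then have "card {e \<in> edges G. e \<subseteq> S} \<le> card (cross \<union> (\<lambda>v. {v, par v}) ` (S - X))"
    using fin by (intro card_mono) auto
  also have "\<dots> \<le> card cross + card ((\<lambda>v. {v, par v}) ` (S - X))"
    by (rule card_Un_le)
  also have "\<dots> \<le> card cross + card (S - X)"
    using fin by (intro add_left_mono card_image_le) auto
  also have "card cross = card (edges minor)"
    using card_image[OF cross_inj] by (simp add: minor_def edges_def)
  also have "card (S - X) = card S - card X"
    using assms fin finite_subset by (intro card_Diff_subset) auto
  finally show ?thesis using card_mono[OF fin(1) assms(2)] by simp
qed

end

lemma voronoi_minor:
  fixes G :: "'a graph"
  assumes "fin_simple_graph G" "X \<subseteq> S" "S \<subseteq> nbhd G X r" "X \<subseteq> verts G" "enat (4 * r + 2) < girth G"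
  obtains H :: "'a graph" where "shallow_minor (real r) H G" "verts H = X"
    "card {e \<in> edges G. e \<subseteq> S} + card X \<le> card (edges H) + card S"
proof -
  interpret voronoi G X r by unfold_locales (use assms in auto)
  show thesis
    using that[OF shallow_minor] card_edges_minor[OF assms(3,2)] by (simp add: minor_def verts_def)
qed

section \<open>Covering most branch vertices by few balls\<close>

lemma degree_eq_card_incident:
  assumes "fin_simple_graph G"
  shows "card {e \<in> edges G. v \<in> e} = degree G v"
proof -
  have "{e \<in> edges G. v \<in> e} = (\<lambda>u. {u, v}) ` {u. {u, v} \<in> edges G}"
  proof (intro equalityI subsetI)
    fix e assume e: "e \<in> {e \<in> edges G. v \<in> e}"
    then have "e \<in> edges G" by simp
    then obtain x y where "e = {x, y}" by (rule edgeE[OF assms])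
    then consider "e = {x, v}" | "e = {y, v}" using e by auto
    then show "e \<in> (\<lambda>u. {u, v}) ` {u. {u, v} \<in> edges G}" using e by cases auto
  qed auto
  moreover have "inj_on (\<lambda>u. {u, v}) {u. {u, v} \<in> edges G}"
    by (auto simp: inj_on_def doubleton_eq_iff)
  ultimately show ?thesis by (simp add: card_image degree_def)
qed

lemma handshake:
  assumes "fin_simple_graph G"
  shows "(\<Sum>v\<in>verts G. degree G v) = 2 * card (edges G)"
proof -
  have "(\<Sum>v\<in>verts G. card {e \<in> edges G. v \<in> e}) = (\<Sum>e\<in>edges G. 2)"
  proof (rule sum_multicount_gen)
    show "finite (verts G)" using assms by (simp add: fin_simple_graph_def)
    show "finite (edges G)" by (rule finite_edges[OF assms])
    show "\<forall>e\<in>edges G. card {v \<in> verts G. v \<in> e} = 2"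
    proof
      fix e assume "e \<in> edges G"
      then obtain x y where "e = {x, y}" "x \<noteq> y" "x \<in> verts G" "y \<in> verts G"
        by (rule edgeE[OF assms])
      then have "{v \<in> verts G. v \<in> e} = {x, y}" by auto
      then show "card {v \<in> verts G. v \<in> e} = 2" using \<open>x \<noteq> y\<close> by simp
    qed
  qed
  then show ?thesis by (simp add: degree_eq_card_incident[OF assms])
qed

lemma card_edges_remove_vertex:
  assumes G: "fin_simple_graph G" and "v \<in> S"
  shows "card {e \<in> edges G. e \<subseteq> S} \<le> card {e \<in> edges G. e \<subseteq> S - {v}} + card {u \<in> S. adj G u v}"
proof -
  have fin: "finite (edges G)" by (rule finite_edges[OF G])
  have fin': "finite {u \<in> S. adj G u v}"
    by (rule finite_subset[OF _ finite_nbrs[OF G, of v]]) (auto simp: adj_def)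
  have "{e \<in> edges G. e \<subseteq> S} \<subseteq> {e \<in> edges G. e \<subseteq> S - {v}} \<union> (\<lambda>u. {u, v}) ` {u \<in> S. adj G u v}"
  proof
    fix e assume e: "e \<in> {e \<in> edges G. e \<subseteq> S}"
    show "e \<in> {e \<in> edges G. e \<subseteq> S - {v}} \<union> (\<lambda>u. {u, v}) ` {u \<in> S. adj G u v}"
    proof (cases "v \<in> e")
      case True
      have "e \<in> edges G" using e by simp
      then obtain x y where xy: "e = {x, y}" by (rule edgeE[OF G])
      define z where "z = (if x = v then y else x)"
      have "e = {z, v}" using True xy by (auto simp: z_def)
      then have "z \<in> {u \<in> S. adj G u v}" using e by (simp add: adj_def)
      then show ?thesis using \<open>e = {z, v}\<close> by blast
    next
      case False
      then show ?thesis using e by blast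
    qed
  qed
  then have "card {e \<in> edges G. e \<subseteq> S} \<le>
      card ({e \<in> edges G. e \<subseteq> S - {v}} \<union> (\<lambda>u. {u, v}) ` {u \<in> S. adj G u v})"
    using fin fin' by (intro card_mono) auto
  also have "\<dots> \<le> card {e \<in> edges G. e \<subseteq> S - {v}} + card ((\<lambda>u. {u, v}) ` {u \<in> S. adj G u v})"
    by (rule card_Un_le)
  also have "\<dots> \<le> card {e \<in> edges G. e \<subseteq> S - {v}} + card {u \<in> S. adj G u v}"
    by (intro add_left_mono card_image_le fin')
  finally show ?thesis .
qed

lemma card_edges_remove_set:
  assumes G: "fin_simple_graph G" and "finite U"
  shows "card (edges G) \<le> card {e \<in> edges G. e \<subseteq> verts G - U} + (\<Sum>u\<in>U. degree G u)"
proof -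
  have fin: "finite (edges G)" by (rule finite_edges[OF G])
  have "edges G \<subseteq> {e \<in> edges G. e \<subseteq> verts G - U} \<union> (\<Union>u\<in>U. {e \<in> edges G. u \<in> e})"
  proof
    fix e assume e: "e \<in> edges G"
    then obtain x y where "e = {x, y}" "x \<in> verts G" "y \<in> verts G"
      by (rule edgeE[OF G])
    then show "e \<in> {e \<in> edges G. e \<subseteq> verts G - U} \<union> (\<Union>u\<in>U. {e \<in> edges G. u \<in> e})"
      using e by auto
  qed
  then have "card (edges G) \<le>
      card ({e \<in> edges G. e \<subseteq> verts G - U} \<union> (\<Union>u\<in>U. {e \<in> edges G. u \<in> e}))"
    using fin assms(2) by (intro card_mono) auto
  also have "\<dots> \<le> card {e \<in> edges G. e \<subseteq> verts G - U} + card (\<Union>u\<in>U. {e \<in> edges G. u \<in> e})"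
    by (rule card_Un_le)
  also have "\<dots> \<le> card {e \<in> edges G. e \<subseteq> verts G - U} + (\<Sum>u\<in>U. card {e \<in> edges G. u \<in> e})"
    by (intro add_left_mono card_UN_le assms(2))
  finally show ?thesis by (simp add: degree_eq_card_incident[OF G])
qed

text \<open>Peeling off vertices of degree at most one never decreases the number of edges minus the number
  of vertices.\<close>

lemma peel:
  assumes G: "fin_simple_graph G" and "X \<subseteq> S\<^sub>0" "S\<^sub>0 \<subseteq> verts G"
  obtains S where "X \<subseteq> S" "S \<subseteq> S\<^sub>0"
    "card {e \<in> edges G. e \<subseteq> S\<^sub>0} + card S \<le> card {e \<in> edges G. e \<subseteq> S} + card S\<^sub>0"
    "\<And>v. v \<in> S - X \<Longrightarrow> 2 \<le> card {u \<in> S. adj G u v}"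
proof -
  define P where "P S \<longleftrightarrow> X \<subseteq> S \<and> S \<subseteq> S\<^sub>0 \<and>
    card {e \<in> edges G. e \<subseteq> S\<^sub>0} + card S \<le> card {e \<in> edges G. e \<subseteq> S} + card S\<^sub>0" for S
  have "P S\<^sub>0" using assms by (simp add: P_def)
  \<comment> \<open>A set of least cardinality with property \<open>P\<close> replaces the peeling
    process: removing a vertex with at most one neighbour loses one vertex and at most one edge, so
    \<open>P\<close> would persist.\<close>
  then obtain S where S: "P S" and min: "\<And>S'. P S' \<Longrightarrow> card S \<le> card S'"
    using ex_has_least_nat[of P "S\<^sub>0" card] by metis
  have fin: "finite S"
    using S assms G finite_subset[of S "verts G"] by (auto simp: P_def fin_simple_graph_def)
  show thesis
  proof (rule that[of S])
    show "X \<subseteq> S" "S \<subseteq> S\<^sub>0"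
      "card {e \<in> edges G. e \<subseteq> S\<^sub>0} + card S \<le> card {e \<in> edges G. e \<subseteq> S} + card S\<^sub>0"
      using S unfolding P_def by blast+
    fix v assume v: "v \<in> S - X"
    then have c: "card S = Suc (card (S - {v}))" using fin card.remove[of S v] by simp
    show "2 \<le> card {u \<in> S. adj G u v}"
    proof (rule ccontr)
      assume "\<not> 2 \<le> card {u \<in> S. adj G u v}"
      then have "P (S - {v})"
        using S v c card_edges_remove_vertex[OF G, of v S] unfolding P_def by auto
      then show False using min[of "S - {v}"] c by simp
    qed
  qed
qed

section \<open>Greedy covering by balls\<close>

lemma walk_nth_nbhd: "walk G xs \<Longrightarrow> i + n < length xs \<Longrightarrow> xs ! (i + n) \<in> nbhd G {xs ! i} n"
proof (induction n)
  case (Suc n)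
  then have "xs ! (i + n) \<in> nbhd G {xs ! i} n" "adj G (xs ! Suc (i + n)) (xs ! (i + n))"
    by (auto simp: walk_def adj_commute)
  then show ?case by auto
qed simp

text \<open>Every chosen centre pays for new weight M / c. A ball that still adds that much could be
  added to the choice, so a largest admissible set of centres leaves no such ball.\<close>

lemma greedy_cover:
  fixes w :: "'a \<Rightarrow> nat"
  assumes "finite V" "\<And>S. S \<subseteq> V \<Longrightarrow> nbhd G S r \<subseteq> V" "0 < M"
  obtains X where "X \<subseteq> V" "M * card X \<le> c * sum w (nbhd G X r)"
    "\<And>x. x \<in> V \<Longrightarrow> c * sum w (nbhd G {x} r - nbhd G X r) < M"
proof -
  define P where "P X \<longleftrightarrow> X \<subseteq> V \<and> M * card X \<le> c * sum w (nbhd G X r)" for X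
  have "P {}" by (simp add: P_def)
  moreover have "\<forall>X. P X \<longrightarrow> card X < Suc (card V)"
    using card_mono[OF assms(1)] by (auto simp: P_def less_Suc_eq_le)
  \<comment> \<open>Admissible sets lie in V, so their size is bounded and a largest one exists; no
    greedy loop is run.\<close>
  ultimately obtain X where X: "P X" and max: "\<And>Y. P Y \<Longrightarrow> card Y \<le> card X"
    using ex_has_greatest_nat[of P "{}" card "Suc (card V)"] by metis
  show thesis
  proof (rule that[of X])
    show XV: "X \<subseteq> V" "M * card X \<le> c * sum w (nbhd G X r)" using X by (auto simp: P_def)
    fix x assume x: "x \<in> V"
    show "c * sum w (nbhd G {x} r - nbhd G X r) < M"
    proof (rule ccontr)
      assume ge: "\<not> c * sum w (nbhd G {x} r - nbhd G X r) < M"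
      have "x \<notin> X"
      proof
        assume "x \<in> X"
        then have "nbhd G {x} r \<subseteq> nbhd G X r" using nbhd_eq_UN[of G X r] by blast
        then have "nbhd G {x} r - nbhd G X r = {}" by blast
        then have "sum w (nbhd G {x} r - nbhd G X r) = 0" by (simp only: sum.empty)
        then show False using ge assms(3) by simp
      qed
      have fin: "finite (nbhd G X r)" "finite (nbhd G {x} r - nbhd G X r)"
        using assms(2)[of X] assms(2)[of "{x}"] XV(1) x
        by (auto intro: finite_Diff finite_subset[OF _ assms(1)])
      have "nbhd G (insert x X) r = nbhd G X r \<union> (nbhd G {x} r - nbhd G X r)"
        using nbhd_Un[of G "{x}" X r] by (simp add: Un_commute)
      moreover have "sum w (nbhd G X r \<union> (nbhd G {x} r - nbhd G X r)) =
          sum w (nbhd G X r) + sum w (nbhd G {x} r - nbhd G X r)"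
        by (rule sum.union_disjoint[OF fin]) blast
      ultimately have "c * sum w (nbhd G (insert x X) r) =
          c * sum w (nbhd G X r) + c * sum w (nbhd G {x} r - nbhd G X r)"
        by (simp only: distrib_left)
      moreover have "card (insert x X) = Suc (card X)"
        using \<open>x \<notin> X\<close> finite_subset[OF XV(1) assms(1)] by simp
      moreover from this have "M * card (insert x X) = M * card X + M" by simp
      ultimately have "P (insert x X)"
        using XV ge x unfolding P_def by simp
      then show False using max[of "insert x X"] \<open>card (insert x X) = Suc (card X)\<close> by simp
    qed
  qed
qed

section \<open>A dense shallow minor of an irreducible graph\<close>

locale subdivided_girth = subdivided +
  fixes j :: nat
  assumes girth_j: "enat ((4 * j + 4) * (p - 1)) < girth G"
    and nonempty: "verts G \<noteq> {}"
begin

definition r0 where "r0 = j * (p - 1)"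
definition h where "h = (p - 1) div 2"
definition M :: nat where "M = 3 * 2 ^ j - 2"

lemma M_pos: "0 < M" and M_eq: "M + 2 = 3 * 2 ^ j"
proof -
  have "(1::nat) \<le> 2 ^ j" by simp
  then show "0 < M" "M + 2 = 3 * 2 ^ j" unfolding M_def by linarith+
qed

lemma girth_gt: "n \<le> (4 * j + 4) * (p - 1) \<Longrightarrow> enat n < girth G"
  using girth_j by (metis enat_ord_simps(1) le_less_trans)

lemma excess_ball_ge:
  assumes "v \<in> verts G" "0 < excess G v"
  shows "M \<le> sum (excess G) (nbhd G {v} r0)"
proof -
  have "enat (2 * (j * (p - 1))) < girth G" by (rule girth_gt) (simp add: algebra_simps)
  then show ?thesis unfolding M_def r0_def by (rule excess_nbhd_ge[OF assms])
qed

text \<open>A walk of p edges from any vertex cannot be an ear. This is what makes the set of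
  centres nonempty.\<close>

lemma branch_vertex_exists: "\<exists>v\<in>verts G. 0 < excess G v"
proof -
  obtain x where "x \<in> verts G" using nonempty by auto
  then have "nbwalk G [x]" by simp
  then obtain zs where zs: "length zs = p" "nbwalk G (zs @ [x])" by (rule nbwalk_extend)
  have "length (zs @ [x]) = Suc p" using zs(1) by simp
  then obtain as c bs where c: "zs @ [x] = as @ c # bs" "degree G c \<ge> 3"
    by (rule nbwalk_branch_vertex[OF zs(2)])
  have "c \<in> set (zs @ [x])" using c(1) by simp
  then have "c \<in> verts G" using nbwalk_verts[OF simple zs(2)] by blast
  then show ?thesis using c(2) by (intro bexI[of _ c]) (auto simp: excess_def)
qed

text \<open>Double counting of pairs (u, x) with u uncovered and x in the ball of u, weighted by the
  product of their weights. Summed over u the total is at least M times the uncovered weight. Since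
  balls are symmetric, summing over x instead meets only the uncovered part of each ball, below M /
  8.\<close>

lemma uncovered_excess_le:
  assumes N: "\<And>x. x \<in> verts G \<Longrightarrow> 8 * sum (excess G) (nbhd G {x} r0 - N) < M"
  shows "8 * sum (excess G) (verts G - N) \<le> sum (excess G) (verts G)"
proof -
  let ?V = "verts G" and ?w = "excess G" and ?B = "\<lambda>x. nbhd G {x} r0"
  have B: "?B x \<subseteq> ?V" if "x \<in> ?V" for x using nbhd_subset_verts[OF simple, of "{x}"] that by auto
  have "M * (8 * sum ?w (?V - N)) = 8 * (\<Sum>u\<in>?V - N. ?w u * M)"
    unfolding sum_distrib_right[symmetric] by simp
  also have "\<dots> \<le> 8 * (\<Sum>u\<in>?V - N. ?w u * sum ?w (?B u))"
  proof (rule mult_left_mono[OF sum_mono])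
    fix u assume "u \<in> ?V - N"
    \<comment> \<open>The ball bound is known for branch vertices only; for the others both sides
      are 0.\<close>
    then show "?w u * M \<le> ?w u * sum ?w (?B u)"
      using excess_ball_ge[of u] by (cases "?w u = 0") auto
  qed simp
  also have "(\<Sum>u\<in>?V - N. ?w u * sum ?w (?B u)) =
      (\<Sum>u\<in>?V - N. \<Sum>x\<in>?V. if x \<in> ?B u then ?w u * ?w x else 0)"
  proof (rule sum.cong)
    fix u assume "u \<in> ?V - N"
    then have "?V \<inter> ?B u = ?B u" using B by auto
    then show "?w u * sum ?w (?B u) = (\<Sum>x\<in>?V. if x \<in> ?B u then ?w u * ?w x else 0)"
      using sum.inter_restrict[of ?V "\<lambda>x. ?w u * ?w x" "?B u"] by (simp add: sum_distrib_left)
  qed simp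
  also have "\<dots> = (\<Sum>x\<in>?V. \<Sum>u\<in>?V - N. if x \<in> ?B u then ?w u * ?w x else 0)"
    by (rule sum.swap)
  also have "\<dots> = (\<Sum>x\<in>?V. ?w x * sum ?w (?B x - N))"
  proof (rule sum.cong)
    fix x assume "x \<in> ?V"
    then have "(?V - N) \<inter> ?B x = ?B x - N" using B by auto
    then show "(\<Sum>u\<in>?V - N. if x \<in> ?B u then ?w u * ?w x else 0) = ?w x * sum ?w (?B x - N)"
      using sum.inter_restrict[of "?V - N" "\<lambda>u. ?w u * ?w x" "?B x"]
      by (simp add: nbhd_sym[of x G] sum_distrib_left mult.commute)
  qed simp
  also have "8 * \<dots> = (\<Sum>x\<in>?V. ?w x * (8 * sum ?w (?B x - N)))"
    by (simp add: sum_distrib_left mult.left_commute)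
  also have "\<dots> \<le> (\<Sum>x\<in>?V. ?w x * M)"
    using N by (intro sum_mono mult_left_mono) (auto intro: less_imp_le)
  also have "\<dots> = M * sum ?w ?V" by (simp add: sum_distrib_left mult.commute)
  finally show ?thesis using M_pos by simp
qed

text \<open>A vertex of the core that is far from all roots would be the middle of an ear of length at
  least \<open>2 * h + 2 \<ge> p\<close>.\<close>

lemma core_covered:
  assumes S: "S \<subseteq> verts G" and X: "X \<subseteq> verts G"
    and core: "\<And>v. v \<in> S - X \<Longrightarrow> 2 \<le> card {u \<in> S. adj G u v}"
    and branch: "\<And>v. v \<in> S \<Longrightarrow> 0 < excess G v \<Longrightarrow> v \<in> nbhd G X r0"
  shows "S \<subseteq> nbhd G X (r0 + h)"
proof
  fix v assume v: "v \<in> S"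
  show "v \<in> nbhd G X (r0 + h)"
  proof (rule ccontr)
    assume far: "v \<notin> nbhd G X (r0 + h)"
    have far': "u \<notin> nbhd G X r0" if "u \<in> nbhd G {v} i" "i \<le> h" for u i
    proof
      assume "u \<in> nbhd G X r0"
      then have "nbhd G {u} i \<subseteq> nbhd G (nbhd G X r0) i"
        using nbhd_eq_UN[of G "nbhd G X r0" i] by blast
      then have "v \<in> nbhd G X (r0 + i)" using that(1) nbhd_sym[of u G v i] nbhd_add[of G X r0 i] by blast
      then show False using far nbhd_mono[of "r0 + i" "r0 + h" G X] that(2) by auto
    qed
    have deg2: "degree G u = 2" if "u \<in> S" "u \<notin> nbhd G X r0" for u
    proof -
      have "excess G u = 0" using branch[OF that(1)] that(2) by auto
      then show ?thesis using degree_eq[of u] S that(1) by auto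
    qed
    \<comment> \<open>Such a vertex has degree 2 in \<open>G\<close> and two neighbours in
      \<open>S\<close>, so none of its neighbours is missing from \<open>S\<close>. Hence the ball
      of radius \<open>h\<close> around \<open>v\<close> stays inside \<open>S\<close>.\<close>
    have closed: "z \<in> S" if u: "u \<in> S" "u \<notin> nbhd G X r0" and z: "adj G z u" for u z
    proof -
      have "u \<notin> X" using u(2) nbhd_mono[of 0 r0 G X] by auto
      then have "2 \<le> card {u' \<in> S. adj G u' u}" using core u(1) by auto
      moreover have "{u' \<in> S. adj G u' u} \<subseteq> {u'. {u', u} \<in> edges G}" by (auto simp: adj_def)
      moreover have "card {u'. {u', u} \<in> edges G} = 2" using deg2[OF u] by (simp add: degree_def)
      ultimately have "{u' \<in> S. adj G u' u} = {u'. {u', u} \<in> edges G}"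
        using finite_nbrs[OF simple, of u] by (intro card_seteq) auto
      then show ?thesis using z by (auto simp: adj_def)
    qed
    have ball: "i \<le> h \<Longrightarrow> nbhd G {v} i \<subseteq> S" for i
    proof (induction i)
      case (Suc i)
      then show ?case using closed far'[of _ i] by auto
    qed (use v in simp)
    have ball2: "degree G u = 2" if "u \<in> nbhd G {v} h" for u
      using deg2 ball far'[OF that] that by blast
    have "degree G v = 2" using deg2 v far'[of v 0] by simp
    then obtain a b where ab: "{u. {u, v} \<in> edges G} = {a, b}" "a \<noteq> b"
      by (auto simp: degree_def card_2_iff)
    then have "nbwalk G [a, v]" "nbwalk G [b, v]" using v S by (auto simp: adj_def)
    then obtain as bs where as: "length as = h" "nbwalk G (as @ [a, v])"
      and bs: "length bs = h" "nbwalk G (bs @ [b, v])"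
      using nbwalk_extend by metis
    \<comment> \<open>A walk of \<open>2 * h + 2\<close> edges with \<open>v\<close> exactly in the
      middle, at index \<open>Suc h\<close>; its first p edges contain an internal branch vertex
      c.\<close>
    define L where "L = (as @ [a]) @ v # b # rev bs"
    have "nbwalk G ((as @ [a]) @ [v])" using as by simp
    moreover have "nbwalk G (v # b # rev bs)" using nbwalk_rev[OF simple bs(2)] by simp
    ultimately have L: "nbwalk G L"
      unfolding L_def by (rule nbwalk_join) (use ab in simp)
    have lenL: "length L = 2 * h + 3" using as bs by (simp add: L_def)
    have hp: "p \<le> 2 * h + 2" using p unfolding h_def by linarith
    have "nbwalk G (take (Suc p) L @ drop (Suc p) L)" using L by simp
    then have "nbwalk G (take (Suc p) L)"
      by (rule nbwalk_prefix[OF _ simple]) (use lenL in auto)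
    moreover have "length (take (Suc p) L) = Suc p" using lenL hp by simp
    ultimately obtain cs c ds where c: "take (Suc p) L = cs @ c # ds" "cs \<noteq> []" "ds \<noteq> []" "degree G c \<ge> 3"
      by (rule nbwalk_branch_vertex)
    define i where "i = length cs"
    have "length (take (Suc p) L) = i + Suc (length ds)" using c(1) by (simp add: i_def)
    then have i: "0 < i" "i < p"
      using c(2,3) \<open>length (take (Suc p) L) = Suc p\<close> by (auto simp: i_def)
    have Li: "L ! i = c"
      using c(1) i nth_take[of i "Suc p" L] by (simp add: i_def nth_append)
    have Lv: "L ! Suc h = v" using as by (simp add: L_def nth_append)
    \<comment> \<open>Since 0 < i < p and p is at most \<open>2 * h + 2\<close>, the index of c
      differs from \<open>Suc h\<close> by at most \<open>h\<close>; but all degrees in this ball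
      are 2.\<close>
    have "c \<in> nbhd G {v} h"
    proof (cases "Suc h \<le> i")
      case True
      then have "L ! (Suc h + (i - Suc h)) \<in> nbhd G {L ! Suc h} (i - Suc h)"
        using lenL i hp by (intro walk_nth_nbhd nbwalk_walk[OF simple L]) auto
      then have "c \<in> nbhd G {v} (i - Suc h)" using Li Lv True by simp
      moreover have "i - Suc h \<le> h" using i hp by simp
      ultimately show ?thesis using nbhd_mono[of "i - Suc h" h G "{v}"] by auto
    next
      case False
      then have "L ! (i + (Suc h - i)) \<in> nbhd G {L ! i} (Suc h - i)"
        using lenL by (intro walk_nth_nbhd nbwalk_walk[OF simple L]) auto
      then have "v \<in> nbhd G {c} (Suc h - i)" using Li Lv False by simp
      then have "c \<in> nbhd G {v} (Suc h - i)" by (simp add: nbhd_sym)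
      moreover have "Suc h - i \<le> h" using i by simp
      ultimately show ?thesis using nbhd_mono[of "Suc h - i" h G "{v}"] by auto
    qed
    then show False using ball2 c(4) by simp
  qed
qed

theorem dense_minor:
  obtains H :: "'a graph" where "shallow_minor (real (r0 + h)) H G" "verts H \<noteq> {}"
    "(3 * 2 ^ j + 30) * card (verts H) \<le> 32 * card (edges H)"
proof -
  let ?V = "verts G" and ?w = "excess G"
  obtain X where X: "X \<subseteq> ?V" "M * card X \<le> 8 * sum ?w (nbhd G X r0)"
    "\<And>x. x \<in> ?V \<Longrightarrow> 8 * sum ?w (nbhd G {x} r0 - nbhd G X r0) < M"
    using greedy_cover[of ?V G r0 M 8 ?w] nbhd_subset_verts[OF simple] M_pos by auto
  define U where "U = {u \<in> ?V - nbhd G X r0. 0 < ?w u}"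
  have finU: "finite U" by (simp add: U_def)
  have wU: "8 * sum ?w U \<le> sum ?w ?V"
  proof -
    have "sum ?w U = sum ?w (?V - nbhd G X r0)"
      unfolding U_def by (rule sum.mono_neutral_left) auto
    then show ?thesis using uncovered_excess_le[OF X(3)] by simp
  qed
  have cardU: "card U \<le> sum ?w U"
  proof -
    have "(\<Sum>u\<in>U. 1) \<le> sum ?w U" by (rule sum_mono) (auto simp: U_def)
    then show ?thesis by simp
  qed
  have "X \<subseteq> ?V - U" using X(1) nbhd_mono[of 0 r0 G X] by (auto simp: U_def)
  then obtain S where S: "X \<subseteq> S" "S \<subseteq> ?V - U"
    "card {e \<in> edges G. e \<subseteq> ?V - U} + card S \<le> card {e \<in> edges G. e \<subseteq> S} + card (?V - U)"
    "\<And>v. v \<in> S - X \<Longrightarrow> 2 \<le> card {u \<in> S. adj G u v}"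
    using peel[OF simple, of X "?V - U"] by blast
  have "S \<subseteq> nbhd G X (r0 + h)"
    using S X(1) by (intro core_covered) (auto simp: U_def)
  moreover have "enat (4 * (r0 + h) + 2) < girth G"
  proof (rule girth_gt)
    \<comment> \<open>\<open>4 * h\<close> is at most \<open>2 * (p - 1)\<close>, and so is 2
      because p is at least 2.\<close>
    have "4 * h + 2 \<le> 4 * (p - 1)" using p unfolding h_def by linarith
    then show "4 * (r0 + h) + 2 \<le> (4 * j + 4) * (p - 1)" by (simp add: r0_def algebra_simps)
  qed
  ultimately obtain H :: "'a graph" where H: "shallow_minor (real (r0 + h)) H G" "verts H = X"
    "card {e \<in> edges G. e \<subseteq> S} + card X \<le> card (edges H) + card S"
    using voronoi_minor[OF simple S(1) _ X(1)] by metis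
  have "2 * card (edges G) = (\<Sum>v\<in>?V. ?w v + 2)"
    using handshake[OF simple] degree_eq by simp
  then have edges: "2 * card (edges G) = sum ?w ?V + 2 * card ?V"
    unfolding sum.distrib by simp
  have "(\<Sum>u\<in>U. degree G u) = (\<Sum>u\<in>U. ?w u + 2)"
    using degree_eq by (intro sum.cong) (auto simp: U_def)
  then have degU: "(\<Sum>u\<in>U. degree G u) = sum ?w U + 2 * card U"
    unfolding sum.distrib by simp
  have "card (?V - U) = card ?V - card U" "card U \<le> card ?V"
    using finU by (auto simp: U_def intro!: card_Diff_subset card_mono)
  \<comment> \<open>Deleting \<open>U\<close> removes at most \<open>sum ?w U + 2 * card U\<close>
    edges and exactly \<open>card U\<close> vertices, so |E| - |V| loses at most twice the weight of
    \<open>U\<close>, a quarter of the total weight; the other quarter remains.\<close>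
  then have "sum ?w ?V + 4 * card X \<le> 4 * card (edges H)"
    using card_edges_remove_set[OF simple finU] edges degU S(3) H(3) wU cardU by linarith
  moreover have "sum ?w (nbhd G X r0) \<le> sum ?w ?V"
    using nbhd_subset_verts[OF simple X(1)] by (intro sum_mono2) auto
  \<comment> \<open>Eightfold multiplication of the edge bound meets the covering bound
    \<open>M * card X\<close>, at most 8 times the total weight: this is where 32 comes
    from.\<close>
  ultimately have "M * card X + 32 * card X \<le> 32 * card (edges H)" using X(2) by linarith
  moreover have "3 * 2 ^ j + 30 = M + 32" using M_eq by simp
  ultimately have "(3 * 2 ^ j + 30) * card (verts H) \<le> 32 * card (edges H)"
    using H(2) by (simp add: distrib_right)
  moreover have "X \<noteq> {}"
  proof
    assume "X = {}"
    then have "nbhd G X r0 = {}" using nbhd_eq_UN[of G X r0] by simp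
    moreover obtain v where v: "v \<in> ?V" "0 < ?w v" using branch_vertex_exists by auto
    ultimately have "8 * sum ?w (nbhd G {v} r0) < M" using X(3)[of v] by simp
    then show False using excess_ball_ge[OF v] by simp
  qed
  ultimately show thesis using that H by metis
qed

end

section \<open>Reducing to graphs without long ears\<close>

lemma shallow_minor_mono:
  assumes "shallow_minor r H G'" "verts G' \<subseteq> verts G" "edges G' \<subseteq> edges G"
  shows "shallow_minor r H G"
proof -
  have sub: "subgraph T G' \<Longrightarrow> subgraph T G" for T
    using assms(2,3) unfolding subgraph_def by blast
  obtain T rt where "fin_simple_graph H"
    "\<forall>v\<in>verts H. subgraph (T v) G' \<and> is_tree (T v) \<and> rt v \<in> verts (T v) \<and>
       (\<forall>w\<in>verts (T v). real (gdist (T v) (rt v) w) \<le> of_int \<lceil>r\<rceil>)"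
    "\<forall>u\<in>verts H. \<forall>v\<in>verts H. u \<noteq> v \<longrightarrow> verts (T u) \<inter> verts (T v) = {}"
    "\<forall>u v. {u, v} \<in> edges H \<longrightarrow> (\<exists>x\<in>verts (T u). \<exists>y\<in>verts (T v). {x, y} \<in> edges G' \<and>
       real (gdist (T u) (rt u) x + 1 + gdist (T v) y (rt v)) \<le> 2 * r + 1)"
    using assms(1) unfolding shallow_minor_def by blast
  then show ?thesis
    unfolding shallow_minor_def using sub assms(3)
    by (intro conjI exI[of _ T] exI[of _ rt]) (simp_all, meson subsetD)
qed

text \<open>Disjoint trees have distinct roots. This bounds the set of densities, as the real
  supremum in \<open>nabla\<close> requires.\<close>

lemma shallow_minor_card_le:
  assumes G: "fin_simple_graph G" and "shallow_minor r H G"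
  shows "card (verts H) \<le> card (verts G)"
proof -
  obtain T rt where T: "\<forall>v\<in>verts H. subgraph (T v) G \<and> is_tree (T v) \<and> rt v \<in> verts (T v) \<and>
       (\<forall>w\<in>verts (T v). real (gdist (T v) (rt v) w) \<le> of_int \<lceil>r\<rceil>)"
    "\<forall>u\<in>verts H. \<forall>v\<in>verts H. u \<noteq> v \<longrightarrow> verts (T u) \<inter> verts (T v) = {}"
    using assms(2) unfolding shallow_minor_def by blast
  have rt: "rt v \<in> verts (T v)" "rt v \<in> verts G" if "v \<in> verts H" for v
    using T(1) that unfolding subgraph_def by blast+
  have "inj_on rt (verts H)"
  proof (rule inj_onI)
    fix u v assume uv: "u \<in> verts H" "v \<in> verts H" "rt u = rt v"
    then have "rt u \<in> verts (T u) \<inter> verts (T v)"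
      using rt(1)[OF uv(1)] rt(1)[OF uv(2)] by simp
    then show "u = v" using T(2) uv by blast
  qed
  then show ?thesis
    using rt(2) G by (intro card_inj_on_le[of rt]) (auto simp: fin_simple_graph_def)
qed

lemma nabla_ge:
  fixes G H :: "'a graph"
  assumes G: "fin_simple_graph G" and H: "shallow_minor r H G" "verts H \<noteq> {}"
  shows "real (card (edges H)) / real (card (verts H)) \<le> nabla r G"
proof -
  let ?D = "{real (card (edges H)) / real (card (verts H)) | H :: 'a graph.
    shallow_minor r H G \<and> verts H \<noteq> {}}"
  have "x \<le> 2 ^ card (verts G)" if x: "x \<in> insert 0 ?D" for x
  proof (cases "x = 0")
    case False
    then obtain K :: "'a graph" where K: "x = real (card (edges K)) / real (card (verts K))"
      "shallow_minor r K G" "verts K \<noteq> {}"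
      using x by blast
    have simple: "fin_simple_graph K" using K(2) unfolding shallow_minor_def by simp
    then have fin: "finite (verts K)" by (simp add: fin_simple_graph_def)
    have "edges K \<subseteq> Pow (verts K)"
    proof
      fix e assume "e \<in> edges K"
      then obtain u v where "e = {u, v}" "u \<in> verts K" "v \<in> verts K" by (rule edgeE[OF simple])
      then show "e \<in> Pow (verts K)" by simp
    qed
    then have "card (edges K) \<le> 2 ^ card (verts K)"
      using card_mono[of "Pow (verts K)" "edges K"] fin by (simp add: card_Pow)
    also have "\<dots> \<le> 2 ^ card (verts G)"
      using shallow_minor_card_le[OF G K(2)] by (intro power_increasing) auto
    finally have "real (card (edges K)) \<le> 2 ^ card (verts G)"
      by (metis of_nat_le_iff of_nat_numeral of_nat_power)
    have "1 \<le> real (card (verts K))"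
      using fin K(3) by (metis One_nat_def Suc_leI card_gt_0_iff of_nat_1 of_nat_le_iff)
    then have "x \<le> real (card (edges K))"
      unfolding K(1) by (simp add: divide_le_eq mult_le_cancel_left1)
    then show ?thesis
      using \<open>real (card (edges K)) \<le> 2 ^ card (verts G)\<close> by (rule order_trans)
  qed simp
  then have "bdd_above (insert 0 ?D)" by (rule bdd_aboveI)
  moreover have "real (card (edges H)) / real (card (verts H)) \<in> ?D" using H by blast
  ultimately show ?thesis
    unfolding nabla_def by (intro cSup_upper insertI2)
qed

lemma verts_delete [simp]: "verts (delete_verts G S) = verts G - S"
  and edges_delete: "edges (delete_verts G S) = {e \<in> edges G. e \<inter> S = {}}"
  by (simp_all add: delete_verts_def verts_def edges_def)

lemma fin_simple_graph_delete:
  assumes "fin_simple_graph G"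
  shows "fin_simple_graph (delete_verts G S)"
  unfolding fin_simple_graph_def
proof (intro conjI ballI)
  show "finite (verts (delete_verts G S))" using assms by (simp add: fin_simple_graph_def)
  fix e assume "e \<in> edges (delete_verts G S)"
  then have e: "e \<in> edges G" "e \<inter> S = {}" by (simp_all add: edges_delete)
  from e(1) obtain u v where "e = {u, v}" "u \<noteq> v" "u \<in> verts G" "v \<in> verts G"
    by (rule edgeE[OF assms])
  then show "\<exists>u v. e = {u, v} \<and> u \<noteq> v \<and> u \<in> verts (delete_verts G S) \<and> v \<in> verts (delete_verts G S)"
    using e(2) by (intro exI[of _ u] exI[of _ v]) simp
qed

lemma girth_delete: "girth G \<le> girth (delete_verts G S)"
proof -
  have "is_cycle G xs" if "is_cycle (delete_verts G S) xs" for xs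
    using that unfolding is_cycle_def gpath_def walk_def by (auto simp: adj_def edges_delete)
  then show ?thesis unfolding girth_def by (intro INF_superset_mono) auto
qed

text \<open>For p at least 2 an ear has an internal vertex, so every reduction makes the graph
  smaller.\<close>

lemma p_reduction_delete:
  assumes "p_reduction p G G'" "2 \<le> p"
  obtains S where "G' = delete_verts G S" "verts G \<inter> S \<noteq> {}"
proof -
  consider v where "v \<in> verts G" "G' = delete_verts G {v}"
    | xs where "strict_ear G xs" "p \<le> length xs - 1" "G' = delete_verts G (set (butlast (tl xs)))"
    using assms(1) unfolding p_reduction_def by blast
  then show thesis
  proof cases
    case 1
    then show thesis using that[of "{v}"] by simp
  next
    case 2
    then obtain x y z ys where xs: "xs = x # y # z # ys"
      using assms(2) by (cases xs; cases "tl xs"; cases "tl (tl xs)") auto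
    then have "y \<in> verts G" using 2(1) by (simp add: strict_ear_def gpath_def walk_def)
    moreover have "y \<in> set (butlast (tl xs))" using xs by simp
    ultimately show thesis using that[of "set (butlast (tl xs))"] 2 by blast
  qed
qed

text \<open>Both the girth bound and the sparsity of shallow minors pass to subgraphs, so reduction
  may continue until it is stuck; a nonempty stuck graph would contradict
  \<open>dense_minor\<close>.\<close>

lemma p_path_degenerate_if_sparse:
  fixes G :: "'a graph"
  assumes p: "2 \<le> p"
    and "fin_simple_graph G"
    and "enat ((4 * j + 4) * (p - 1)) < girth G"
    and "\<And>H :: 'a graph. shallow_minor (real (j * (p - 1) + (p - 1) div 2)) H G \<Longrightarrow> verts H \<noteq> {} \<Longrightarrow>
      32 * card (edges H) < (3 * 2 ^ j + 30) * card (verts H)"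
  shows "p_path_degenerate p G"
  using assms(2-)
proof (induction "card (verts G)" arbitrary: G rule: less_induct)
  case less
  note simple = less.prems(1) and girth = less.prems(2) and sparse = less.prems(3)
  show ?case
  proof (cases "verts G = {}")
    case True
    have "edges G = {}"
    proof (rule ccontr)
      assume "edges G \<noteq> {}"
      then obtain e where "e \<in> edges G" by blast
      then obtain u where "u \<in> verts G" by (rule edgeE[OF simple])
      then show False using True by simp
    qed
    then have "G = ({}, {})" using True by (simp add: verts_def edges_def prod_eq_iff)
    then show ?thesis by (simp add: p_path_degenerate_def)
  next
    case False
    show ?thesis
    proof (cases "\<exists>G'. p_reduction p G G'")
      case True
      then obtain G' where red: "p_reduction p G G'" by blast
      then obtain S where S: "G' = delete_verts G S" "verts G \<inter> S \<noteq> {}"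
        using p by (rule p_reduction_delete)
      have "p_path_degenerate p G'"
      proof (rule less.hyps)
        show "card (verts G') < card (verts G)"
          using S simple by (intro psubset_card_mono) (auto simp: fin_simple_graph_def)
        show "fin_simple_graph G'" unfolding S(1) by (rule fin_simple_graph_delete[OF simple])
        show "enat ((4 * j + 4) * (p - 1)) < girth G'"
          unfolding S(1) by (rule less_le_trans[OF girth girth_delete])
        fix H :: "'a graph"
        assume H: "shallow_minor (real (j * (p - 1) + (p - 1) div 2)) H G'" "verts H \<noteq> {}"
        have "shallow_minor (real (j * (p - 1) + (p - 1) div 2)) H G"
          by (rule shallow_minor_mono[OF H(1)]) (auto simp: S(1) edges_delete)
        then show "32 * card (edges H) < (3 * 2 ^ j + 30) * card (verts H)"
          using H(2) by (rule sparse)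
      qed
      with red show ?thesis
        unfolding p_path_degenerate_def by (rule converse_rtranclp_into_rtranclp)
    next
      case irreducible: False
      interpret subdivided_girth G p j
      proof
        show "fin_simple_graph G" by (rule simple)
        show "2 \<le> p" by (rule p)
        show "2 \<le> degree G v" if "v \<in> verts G" for v
        proof (rule ccontr)
          assume "\<not> 2 \<le> degree G v"
          then have "degree G v = 0 \<or> degree G v = 1" by linarith
          then show False using irreducible that unfolding p_reduction_def by blast
        qed
        show "length xs - 1 < p" if "strict_ear G xs" for xs
        proof (rule ccontr)
          assume "\<not> length xs - 1 < p"
          then have "p_reduction p G (delete_verts G (set (butlast (tl xs))))"
            unfolding p_reduction_def using that by (metis not_le)
          then show False using irreducible by blast
        qed
        have "p \<le> 4 * (p - 1)" using p by simp
        also have "\<dots> \<le> (4 * j + 4) * (p - 1)" by (rule mult_le_mono1) simp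
        finally have "enat p \<le> enat ((4 * j + 4) * (p - 1))" by simp
        then show "enat p < girth G" using girth by (rule le_less_trans)
        show "enat ((4 * j + 4) * (p - 1)) < girth G" by (rule girth)
        show "verts G \<noteq> {}" by (rule False)
      qed
      obtain H :: "'a graph" where H: "shallow_minor (real (r0 + h)) H G" "verts H \<noteq> {}"
        "(3 * 2 ^ j + 30) * card (verts H) \<le> 32 * card (edges H)"
        by (rule dense_minor)
      then show ?thesis using sparse[of H] unfolding r0_def h_def by simp
    qed
  qed
qed

section \<open>The branch of the Lambert function\<close>

text \<open>With z = -w the equation for W_{-1} becomes z exp (-z) = t on z \<ge> 1. Writing x = z +
  d, monotonicity there amounts to z + d < z exp d; the quadratic Taylor term makes it
  strict.\<close>

lemma mult_exp_minus_less:
  fixes x z :: real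
  assumes "1 \<le> z" "z < x"
  shows "x * exp (- x) < z * exp (- z)"
proof -
  define d where "d = x - z"
  have d: "0 < d" "x = z + d" using assms by (simp_all add: d_def)
  have "d \<le> z * d" using assms(1) d(1) by simp
  moreover have "0 < z * (d\<^sup>2 / 2)" using assms(1) d(1) by simp
  ultimately have "x < z + z * d + z * (d\<^sup>2 / 2)" using d by linarith
  also have "\<dots> = z * (1 + d + d\<^sup>2 / 2)" by (simp add: algebra_simps)
  also have "\<dots> \<le> z * exp d"
    using assms(1) d(1) by (intro mult_left_mono exp_lower_Taylor_quadratic) auto
  finally have "x * exp (- x) < z * exp d * exp (- x)" by simp
  also have "z * exp d * exp (- x) = z * exp (- z)"
    unfolding d(2) by (simp add: mult.assoc flip: exp_add)
  finally show ?thesis .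
qed

lemma lambert_Wm1:
  assumes "0 < t" "t \<le> 1 / exp 1"
  shows "lambert_Wm1 (- t) \<le> - 1" "lambert_Wm1 (- t) * exp (lambert_Wm1 (- t)) = - t"
proof -
  have "exp 1 \<ge> (1::real)" by simp
  then have "t \<le> 1" using assms(2) by (smt (verit) divide_le_eq_1_pos)
  then have "1 \<le> 2 / t" using assms(1) by (simp add: le_divide_eq)
  \<comment> \<open>The upper end 2 / t of the interval is chosen so that this crude bound on exp
    brings the function below t.\<close>
  have "(2 / t)\<^sup>2 / 2 \<le> exp (2 / t)"
    using exp_lower_Taylor_quadratic[of "2 / t"] assms(1) by (smt (verit) divide_nonneg_pos)
  then have "2 / t * exp (- (2 / t)) \<le> t"
    using assms(1) by (simp add: exp_minus field_simps power2_eq_square)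
  moreover have "t \<le> 1 * exp (- 1)" using assms(2) by (simp add: exp_minus inverse_eq_divide)
  moreover have "continuous_on {1..2 / t} (\<lambda>z. z * exp (- z))" by (intro continuous_intros)
  ultimately obtain z where z: "1 \<le> z" "z * exp (- z) = t"
    using IVT2'[of "\<lambda>z. z * exp (- z)" "2 / t" t 1] \<open>1 \<le> 2 / t\<close> by blast
  have "\<exists>!w. w \<le> - 1 \<and> w * exp w = - t"
  proof (rule ex1I[of _ "- z"])
    show "- z \<le> - 1 \<and> - z * exp (- z) = - t" using z by simp
    fix w assume w: "w \<le> - 1 \<and> w * exp w = - t"
    then have w': "1 \<le> - w" "- w * exp (- (- w)) = t" by simp_all
    show "w = - z"
      using mult_exp_minus_less[of z "- w"] mult_exp_minus_less[of "- w" z] z w'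
      by (cases "- w" z rule: linorder_cases) auto
  qed
  from theI'[OF this]
  show "lambert_Wm1 (- t) \<le> - 1" "lambert_Wm1 (- t) * exp (lambert_Wm1 (- t)) = - t"
    unfolding lambert_Wm1_def by auto
qed

lemma minus_lambert_Wm1:
  assumes "0 < t" "t \<le> 1 / exp 1"
  shows "1 \<le> - lambert_Wm1 (- t)" "- lambert_Wm1 (- t) * exp (- (- lambert_Wm1 (- t))) = t"
  using lambert_Wm1[OF assms] by simp_all

lemma minus_lambert_Wm1_bounds:
  assumes "0 < t" "t \<le> 1 / exp 1"
  shows "- ln t \<le> - lambert_Wm1 (- t)" "- lambert_Wm1 (- t) \<le> - ln t + ln (2 * - ln t)"
proof -
  define z where "z = - lambert_Wm1 (- t)"
  have z: "1 \<le> z" "z * exp (- z) = t"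
    using minus_lambert_Wm1[OF assms] by (simp_all add: z_def)
  then have ln_t: "ln t = ln z - z" by (auto simp: ln_mult)
  \<comment> \<open>This yields ln z \<le> z / 2, hence z \<le> -2 ln t, which is fed back into z =
    -ln t + ln z.\<close>
  have "0 \<le> (z - 2)\<^sup>2" by simp
  then have "z \<le> 1 + z / 2 + (z / 2)\<^sup>2 / 2" by (simp add: power2_eq_square algebra_simps)
  also have "\<dots> \<le> exp (z / 2)" by (rule exp_lower_Taylor_quadratic) (use z in simp)
  finally have "ln z \<le> ln (exp (z / 2))" using z by (subst ln_le_cancel_iff) auto
  then have "ln z \<le> z / 2" by simp
  then have "z \<le> 2 * - ln t" using ln_t by simp
  then have "ln z \<le> ln (2 * - ln t)" using z by (subst ln_le_cancel_iff) auto
  then show "- ln t \<le> - lambert_Wm1 (- t)" "- lambert_Wm1 (- t) \<le> - ln t + ln (2 * - ln t)"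
    using ln_t z unfolding z_def[symmetric] by auto
qed

section \<open>The growth inequality and the asymptotics of the girth bound\<close>

text \<open>For x = k ln 2 / (2b), the equation x exp (-x) = t says c p k / 2 = exp x; its b-th
  power is equality in the conclusion. Beyond the root x exp (-x) is smaller than t, which turns
  equality into the inequality.\<close>

lemma power_less_of_lambert:
  fixes a b :: real and p :: nat
  defines "t \<equiv> ln 2 / ((24 * sqrt 2 * a) powr (1 / b) * b * real p)"
  assumes "0 < a" "0 < b" "0 < p" "t \<le> 1 / exp 1"
    and k: "- (2 * b / ln 2) * lambert_Wm1 (- t) < k"
  shows "24 * sqrt 2 * a * (real p * k / 2) powr b \<le> 2 powr (k / 2)"
proof -
  define c where "c = (24 * sqrt 2 * a) powr (1 / b)"
  define z where "z = - lambert_Wm1 (- t)"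
  define x where "x = k * ln 2 / (2 * b)"
  have c: "0 < c" using assms(2) by (simp add: c_def)
  have t: "0 < t" "t * (c * b * real p) = ln 2"
    using assms(2-4) c by (simp_all add: t_def c_def)
  have z: "1 \<le> z" "z * exp (- z) = t"
    using minus_lambert_Wm1[OF t(1) assms(5)] by (simp_all add: z_def)
  have "2 * b / ln 2 * z < k" using k by (simp add: z_def)
  then have "z < x" using assms(3) by (simp add: x_def field_simps)
  have kx: "k = 2 * b * x / ln 2" using assms(3) by (simp add: x_def)
  have "0 < x" using z \<open>z < x\<close> by simp
  then have "0 < k" using assms(3) by (simp add: kx)
  have "x * exp (- x) < t" using mult_exp_minus_less[OF z(1) \<open>z < x\<close>] z(2) by simp
  then have "x * exp (- x) * (c * b * real p) < ln 2"
    using c assms(3,4) t(2) by (metis mult_pos_pos mult_strict_right_mono of_nat_0_less_iff)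
  then have "x * (c * b * real p) < ln 2 * exp x"
    by (simp add: exp_minus field_simps)
  then have "c * (real p * k / 2) \<le> exp x"
    by (simp add: kx field_simps)
  then have "(c * (real p * k / 2)) powr b \<le> exp x powr b"
    using c assms(3) \<open>0 < k\<close> by (intro powr_mono2) auto
  also have "exp x powr b = 2 powr (k / 2)"
    using assms(3) by (simp add: powr_def x_def)
  also have "(c * (real p * k / 2)) powr b = 24 * sqrt 2 * a * (real p * k / 2) powr b"
  proof -
    have "c powr b = 24 * sqrt 2 * a" using assms(2,3) by (simp add: c_def powr_powr)
    then show ?thesis using c \<open>0 < k\<close> by (subst powr_mult) auto
  qed
  finally show ?thesis .
qed

lemma gp_asymptotics:
  fixes a b :: real
  assumes "0 < a" "0 < b"
  shows "(\<lambda>p. real_of_int (gp a b p)) \<sim>[at_top] (\<lambda>p. 4 * b * real p * log 2 (real p))"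
proof -
  define K where "K = ln 2 / ((24 * sqrt 2 * a) powr (1 / b) * b)"
  have K: "0 < K" using assms by (simp add: K_def)
  define \<kappa> where "\<kappa> = ln K"
  let ?lo = "\<lambda>p. (2 * (2 * b / ln 2 * (ln (real p) - \<kappa>)) + 2) * (real p - 1)"
  let ?hi = "\<lambda>p. (2 * (2 * b / ln 2 * (ln (real p) - \<kappa> + ln (2 * (ln (real p) - \<kappa>)))) + 11) * (real p - 1)"
  have ev: "eventually (\<lambda>p. K / real p \<le> 1 / exp 1) at_top"
    using K by real_asymp
  have bounds: "?lo p \<le> gp a b p \<and> gp a b p \<le> ?hi p" if "0 < p" "K / real p \<le> 1 / exp 1" for p
  proof -
    define t where "t = K / real p"
    define s where "s = - (2 * b / ln 2) * lambert_Wm1 (- t)"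
    have t: "0 < t" "t \<le> 1 / exp 1" using that K by (simp_all add: t_def)
    have ln_t: "- ln t = ln (real p) - \<kappa>" using that K by (simp add: t_def \<kappa>_def ln_div)
    have gp: "gp a b p = max 7 (2 * \<lfloor>s\<rfloor> + 4) * (int p - 1)"
      unfolding gp_def s_def t_def K_def by (simp add: mult.assoc)
    have s_eq: "s = 2 * b / ln 2 * - lambert_Wm1 (- t)" by (simp add: s_def)
    have s: "2 * b / ln 2 * (ln (real p) - \<kappa>) \<le> s"
      "s \<le> 2 * b / ln 2 * (ln (real p) - \<kappa> + ln (2 * (ln (real p) - \<kappa>)))"
      unfolding s_eq ln_t[symmetric]
      by (rule mult_left_mono, rule minus_lambert_Wm1_bounds[OF t], use assms in simp)+
    have "0 \<le> s"
      unfolding s_eq using minus_lambert_Wm1(1)[OF t] assms(2) by (intro mult_nonneg_nonneg) auto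
    have fl: "s - 1 < of_int \<lfloor>s\<rfloor>" "of_int \<lfloor>s\<rfloor> \<le> s" by linarith+
    \<comment> \<open>The floor costs less than 2 after doubling, and 7 is at most
      \<open>2 * s + 11\<close> as s is nonnegative; neither affects the leading term.\<close>
    then have "2 * s + 2 \<le> real_of_int (2 * \<lfloor>s\<rfloor> + 4)" "real_of_int (2 * \<lfloor>s\<rfloor> + 4) \<le> 2 * s + 11"
      by linarith+
    then have "2 * s + 2 \<le> real_of_int (max 7 (2 * \<lfloor>s\<rfloor> + 4))"
      "real_of_int (max 7 (2 * \<lfloor>s\<rfloor> + 4)) \<le> 2 * s + 11"
      using \<open>0 \<le> s\<close> unfolding of_int_max by (simp_all only: le_max_iff_disj max.bounded_iff) simp_all
    then have "2 * (2 * b / ln 2 * (ln (real p) - \<kappa>)) + 2 \<le> real_of_int (max 7 (2 * \<lfloor>s\<rfloor> + 4))"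
      "real_of_int (max 7 (2 * \<lfloor>s\<rfloor> + 4)) \<le>
        2 * (2 * b / ln 2 * (ln (real p) - \<kappa> + ln (2 * (ln (real p) - \<kappa>)))) + 11"
      using s by linarith+
    moreover have "real_of_int (gp a b p) = real_of_int (max 7 (2 * \<lfloor>s\<rfloor> + 4)) * (real p - 1)"
      unfolding gp by simp
    ultimately show ?thesis using that(1) by (auto intro: mult_right_mono)
  qed
  \<comment> \<open>\<beta> absorbs ln 2, which leaves natural logarithms and one positive
    parameter.\<close>
  define \<beta> where "\<beta> = b / ln 2"
  have \<beta>: "0 < \<beta>" "b = \<beta> * ln 2" using assms(2) by (simp_all add: \<beta>_def)
  have target: "(\<lambda>p. 4 * b * real p * log 2 (real p)) = (\<lambda>p. 4 * \<beta> * real p * ln (real p))"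
    by (simp add: \<beta>(2) log_def mult.assoc)
  have lo: "?lo \<sim>[at_top] (\<lambda>p. 4 * b * real p * log 2 (real p))"
  proof -
    have "(\<lambda>p. (2 * (2 * \<beta> * (ln (real p) - \<kappa>)) + 2) * (real p - 1)) \<sim>[at_top]
        (\<lambda>p. 4 * \<beta> * real p * ln (real p))"
      using \<beta>(1) by real_asymp
    then show ?thesis unfolding target by (simp add: \<beta>(2))
  qed
  have hi: "?hi \<sim>[at_top] (\<lambda>p. 4 * b * real p * log 2 (real p))"
  proof -
    have "(\<lambda>p. (2 * (2 * \<beta> * (ln (real p) - \<kappa> + ln (2 * (ln (real p) - \<kappa>)))) + 11) * (real p - 1))
        \<sim>[at_top] (\<lambda>p. 4 * \<beta> * real p * ln (real p))"
      using \<beta>(1) by real_asymp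
    then show ?thesis unfolding target by (simp add: \<beta>(2))
  qed
  show ?thesis
  proof (rule asymp_equiv_sandwich_real[OF lo hi])
    show "eventually (\<lambda>p. real_of_int (gp a b p) \<in> {?lo p..?hi p}) at_top"
      using ev eventually_gt_at_top[of 0] by eventually_elim (use bounds in auto)
  qed
qed

section \<open>Comparison with the assumed expansion\<close>

theorem mainTheorem2:
  fixes C :: "'a graph set" and a b :: real
  assumes "\<forall>G\<in>C. fin_simple_graph G"
    and "a > 0" and "b > 0"
    and "\<forall>k::nat. Exp C (real k / 2) \<le> ereal (a * (real k / 2 + 1 / 2) powr b)"
  shows "(\<forall>p::nat. p \<ge> 2 \<longrightarrow>
            ln 2 / ((24 * sqrt 2 * a) powr (1 / b) * b * real p) \<le> 1 / exp 1 \<longrightarrow>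
            (\<forall>G\<in>C. girth G > enat (nat (gp a b p)) \<longrightarrow> p_path_degenerate p G))
       \<and> (\<lambda>p::nat. real_of_int (gp a b p)) \<sim>[at_top] (\<lambda>p. 4 * b * real p * log 2 (real p))"
proof (intro conjI allI impI ballI)
  show "(\<lambda>p::nat. real_of_int (gp a b p)) \<sim>[at_top] (\<lambda>p. 4 * b * real p * log 2 (real p))"
    by (rule gp_asymptotics[OF assms(2,3)])
next
  fix p :: nat and G :: "'a graph"
  assume p: "2 \<le> p"
    and t_le: "ln 2 / ((24 * sqrt 2 * a) powr (1 / b) * b * real p) \<le> 1 / exp 1"
    and G: "G \<in> C" and girth: "enat (nat (gp a b p)) < girth G"
  define t where "t = ln 2 / ((24 * sqrt 2 * a) powr (1 / b) * b * real p)"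
  define s where "s = - (2 * b / ln 2) * lambert_Wm1 (- t)"
  have t: "0 < t" "t \<le> 1 / exp 1" using assms(2,3) p t_le by (simp_all add: t_def)
  have "0 \<le> 2 * b / ln 2 * - lambert_Wm1 (- t)"
    using minus_lambert_Wm1(1)[OF t] assms(3) by (intro mult_nonneg_nonneg) auto
  then have "0 \<le> s" by (simp add: s_def)
  define J where "J = nat \<lfloor>s\<rfloor>"
  define j where "j = J div 2"
  define \<rho> where "\<rho> = j * (p - 1) + (p - 1) div 2"
  have J: "\<lfloor>s\<rfloor> = int J" using \<open>0 \<le> s\<close> by (simp add: J_def)
  \<comment> \<open>J + 1 is the least integer strictly above s, as the growth inequality requires;
    J itself is used for the girth.\<close>
  have "s < real (J + 1)" using J by linarith
  then have *: "24 * sqrt 2 * a * (real p * real (J + 1) / 2) powr b \<le> 2 powr (real (J + 1) / 2)"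
    using power_less_of_lambert[OF assms(2,3), of p "real (J + 1)"] p t_le
    unfolding s_def t_def by simp
  have simple: "fin_simple_graph G" using assms(1) G by blast
  have "int (4 * j + 4) * (int p - 1) \<le> gp a b p"
  proof -
    have "int (4 * j + 4) \<le> max 7 (2 * \<lfloor>s\<rfloor> + 4)" unfolding J j_def by linarith
    moreover have "gp a b p = max 7 (2 * \<lfloor>s\<rfloor> + 4) * (int p - 1)"
      unfolding gp_def s_def t_def by simp
    ultimately show ?thesis using p by (simp add: mult_right_mono)
  qed
  then have "int ((4 * j + 4) * (p - 1)) \<le> gp a b p" using p by (simp add: of_nat_diff)
  then have "(4 * j + 4) * (p - 1) \<le> nat (gp a b p)"
    using nat_mono by (metis nat_int)
  then have "enat ((4 * j + 4) * (p - 1)) \<le> enat (nat (gp a b p))" by simp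
  then have girth': "enat ((4 * j + 4) * (p - 1)) < girth G" using girth by (rule le_less_trans)
  \<comment> \<open>Bounds the base \<rho> + 1/2 of the expansion hypothesis by p k / 2 with k = J +
    1.\<close>
  have "2 * \<rho> + 1 \<le> p * (J + 1)"
  proof -
    have "2 * \<rho> + 1 \<le> 2 * j * (p - 1) + p"
      using p unfolding \<rho>_def by (simp add: distrib_left)
    also have "\<dots> \<le> 2 * j * p + p" by simp
    also have "\<dots> = p * (2 * j + 1)" by (simp add: algebra_simps)
    also have "\<dots> \<le> p * (J + 1)" by (intro mult_le_mono2) (simp add: j_def)
    finally show ?thesis .
  qed
  then have "real (2 * \<rho> + 1) \<le> real (p * (J + 1))" by (rule of_nat_mono)
  then have "real \<rho> + 1 / 2 \<le> real p * real (J + 1) / 2" unfolding of_nat_mult by simp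
  then have "a * (real \<rho> + 1 / 2) powr b \<le> a * (real p * real (J + 1) / 2) powr b"
    using assms(2,3) by (intro mult_left_mono powr_mono2) auto
  also have "\<dots> \<le> 2 powr (real (J + 1) / 2) / (24 * sqrt 2)"
    using * by (simp add: field_simps)
  \<comment> \<open>For even J the halving rounds up here, a loss of a factor sqrt 2.\<close>
  also have "\<dots> \<le> 2 powr real (j + 1) / (24 * sqrt 2)"
  proof -
    have "J + 1 \<le> 2 * (j + 1)" unfolding j_def by presburger
    then have "real (J + 1) \<le> real (2 * (j + 1))" by (rule of_nat_mono)
    then have "real (J + 1) / 2 \<le> real (j + 1)" by simp
    then show ?thesis by (intro divide_right_mono powr_mono) auto
  qed
  also have "\<dots> = 2 ^ j * sqrt 2 / 24"
    by (simp add: powr_add powr_realpow field_simps)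
  \<comment> \<open>The coefficient of \<open>2 ^ j\<close> on the left is sqrt 2 / 24, below 1/16,
    against 3/32 on the right.\<close>
  also have "\<dots> < (3 * 2 ^ j + 30) / 32"
  proof -
    have "sqrt 2 < 3 / 2" by (rule real_less_lsqrt) (auto simp: power2_eq_square)
    then have "2 ^ j * sqrt 2 / 24 \<le> 2 ^ j * (3 / 2) / 24"
      by (intro divide_right_mono mult_left_mono) auto
    also have "\<dots> < (3 * 2 ^ j + 30) / 32"
      using zero_le_power[of "2::real" j] by (simp add: field_simps add_strict_increasing2)
    finally show ?thesis .
  qed
  finally have dense: "a * (real \<rho> + 1 / 2) powr b < (3 * 2 ^ j + 30) / 32" .
  show "p_path_degenerate p G"
  proof (rule p_path_degenerate_if_sparse[OF p simple girth'])
    fix H :: "'a graph"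
    assume "shallow_minor (real (j * (p - 1) + (p - 1) div 2)) H G" and ne: "verts H \<noteq> {}"
    then have H: "shallow_minor (real \<rho>) H G" by (simp add: \<rho>_def)
    have "ereal (nabla (real \<rho>) G) \<le> Exp C (real \<rho>)"
      unfolding Exp_def using G by (rule SUP_upper)
    also have "\<dots> \<le> ereal (a * (real \<rho> + 1 / 2) powr b)"
      using assms(4)[rule_format, of "2 * \<rho>"] by simp
    finally have "nabla (real \<rho>) G < (3 * 2 ^ j + 30) / 32" using dense by simp
    with nabla_ge[OF simple H ne]
    have "real (card (edges H)) / real (card (verts H)) < (3 * 2 ^ j + 30) / 32"
      by (rule le_less_trans)
    moreover have "finite (verts H)"
      using H unfolding shallow_minor_def fin_simple_graph_def by blast
    then have "0 < real (card (verts H))" using ne by (simp add: card_gt_0_iff)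
    ultimately have "32 * real (card (edges H)) < (3 * 2 ^ j + 30) * real (card (verts H))"
      by (simp add: field_simps)
    then have "real (32 * card (edges H)) < real ((3 * 2 ^ j + 30) * card (verts H))" by simp
    then show "32 * card (edges H) < (3 * 2 ^ j + 30) * card (verts H)" by (simp only: of_nat_less_iff)
  qed
qed

end
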